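(* Assume that the shift $\theta$ preserves $\mathbb{P}$ and is ergodic, and that there exist constants $\beta\in[1,\infty)$, $(\varepsilon_-,\varepsilon_+)\in(0,\infty)^2$ and a probability measure $\nu$ on $(\mathsf{X},\mathcal{X})$ such that $$\frac{G(\omega,x)}{G(\omega',x')}\le\beta\quad\forall(\omega,\omega',x,x')\in\Omega^2\times\mathsf{X}^2,\qquad \varepsilon_-\nu(\cdot)\le M(\omega,x,\cdot)\le\varepsilon_+\nu(\cdot)\quad\forall(\omega,x)\in\Omega\times\mathsf{X}.$$ Fix $N\ge 1$ arbitrarily. Then for every $\widetilde{\mathbf{M}}\in\mathbb{M}$ there exists a constant $\Upsilon_N(\widetilde{\mathbf{M}})\in[0,\infty)$, independent of the initial distribution $\mu_0$, such that $$\frac1n\log\widetilde{\mathcal{V}}^{\omega}_{n,N}\longrightarrow\Upsilon_N(\widetilde{\mathbf{M}})\quad\text{as } n\to\infty,\quad \text{for }\mathbb{P}\text{-almost all }\omega.$$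
   Context: Let $(\mathsf{X},\mathcal{X})$ and $(\mathsf{Y},\mathcal{Y})$ be measurable spaces, $\Omega=\mathsf{Y}^{\mathbb{Z}}$, $\mathcal{F}=\mathcal{Y}^{\otimes\mathbb{Z}}$, $\mathbb{P}$ a probability measure on $(\Omega,\mathcal{F})$, and $\theta:\Omega\to\Omega$ the shift, $(\theta\omega)(n)=\omega(n+1)$, with iterates $\theta^n$. Let $\mu_0$ be a probability measure on $(\mathsf{X},\mathcal{X})$. Let $M:\Omega\times\mathsf{X}\times\mathcal{X}\to[0,1]$ be such that $M(\omega,x,\cdot)$ is a probability measure for each $(\omega,x)$ and $M(\cdot,\cdot,A)$ is $\mathcal{F}\otimes\mathcal{X}$-measurable for each $A\in\mathcal{X}$. Let $G:\Omega\times\mathsf{X}\to\mathbb{R}_+$ be $\mathcal{F}\otimes\mathcal{X}$-measurable, strictly positive and bounded. For functions and kernels a superscript $\omega$ denotes the $\omega$-section, e.g. $G^\omega(x)=G(\omega,x)$, $M^\omega(x,A)=M(\omega,x,A)$. For fixed $\omega$, $\mathsf{E}^\omega$ denotes expectation under the law of the time-inhomogeneous Markov chain $(X_n)_{n\ge0}$ on $\mathsf{X}$ with $X_0\sim\mu_0$ and $X_n\mid X_{n-1}=x\sim M^{\theta^{n-1}\omega}(x,\cdot)$, $n\ge1$. For $x=(x^1,\dots,x^N),z=(z^1,\dots,z^N)\in\mathsf{X}^N$ put $$\mathbf{M}(\omega,x,dz)=\prod_{i=1}^N\frac{\sum_{j=1}^N G(\omega,x^j)M(\omega,x^j,dz^i)}{\sum_{j=1}^N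 G(\omega,x^j)},\qquad \mathbf{G}(\omega,x)=\frac1N\sum_{i=1}^N G(\omega,x^i).$$ $\mathbb{M}$ is the class of Markov kernels $\widetilde{\mathbf{M}}:\Omega\times\mathsf{X}^N\times\mathcal{X}^{\otimes N}\to[0,1]$ (probability measures in the last argument, jointly measurable in the first two) for which there exist $(\widetilde\varepsilon_-,\widetilde\varepsilon_+)\in(0,\infty)^2$ and a probability measure $\widetilde\nu$ on $(\mathsf{X}^N,\mathcal{X}^{\otimes N})$ with $\widetilde\varepsilon_-\widetilde\nu(\cdot)\le\widetilde{\mathbf{M}}(\omega,x,\cdot)\le\widetilde\varepsilon_+\widetilde\nu(\cdot)$ for all $(\omega,x)\in\Omega\times\mathsf{X}^N$, $\nu^{\otimes N}\ll\widetilde\nu$ and $\int(d\nu^{\otimes N}/d\widetilde\nu)^2\,d\widetilde\nu<\infty$, where $\nu$ is the probability measure in the hypotheses of the claim. For $\widetilde{\mathbf{M}}\in\mathbb{M}$ write $\phi^\omega(x,x')=\frac{d\mathbf{M}^\omega(x,\cdot)}{d\widetilde{\mathbf{M}}^\omega(x,\cdot)}(x')$, $(\omega,x,x')\in\Omega\times\mathsf{X}^{2N}$ (a version of the Radon–Nikodym derivative jointly measurable in $(\omega,x,x')$). For fixed $\omega$, $\widetilde{\mathsf{E}}_N^\omega$ denotes expectation under the law of the $\mathsf{X}^N$-valued Markov chain $(\zeta_n)_{n\ge0}$ with $\zeta_0\sim\mu_0^{\otimes N}$ and $\zeta_n\mid\zeta_{n-1}\sim\widetilde{\mathbf{M}}^{\theta^{n-1}\omega}(\zeta_{n-1},\cdot)$.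 Finally $$\widetilde{\mathcal{V}}^\omega_{n,N}=\frac{\widetilde{\mathsf{E}}_N^\omega\left[\prod_{p=0}^{n-1}\mathbf{G}^{\theta^p\omega}(\zeta_p)^2\,\phi^{\theta^p\omega}(\zeta_p,\zeta_{p+1})^2\right]}{\mathsf{E}^\omega\left[\prod_{p=0}^{n-1}G^{\theta^p\omega}(X_p)\right]^2}.$$ *)

theory Defs
  imports "HOL-Probability.Probability"
begin

abbreviation path_space :: "'y measure \<Rightarrow> (int \<Rightarrow> 'y) measure" where
  "path_space Y \<equiv> PiM UNIV (\<lambda>_. Y)"

text \<open>Both the product space \<open>X\<^sup>N\<close> and the product measure \<open>\<nu>\<^sup>\<otimes>\<^sup>N\<close>; coordinates are numbered
  \<open>0, \<dots>, N - 1\<close>.\<close>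

abbreviation pow_measure :: "nat \<Rightarrow> 'x measure \<Rightarrow> (nat \<Rightarrow> 'x) measure" where
  "pow_measure N X \<equiv> PiM {..<N} (\<lambda>_. X)"

definition seq_shift :: "(int \<Rightarrow> 'y) \<Rightarrow> (int \<Rightarrow> 'y)" where
  "seq_shift \<omega> = (\<lambda>n. \<omega> (n + 1))"

definition measure_preserving :: "'a measure \<Rightarrow> ('a \<Rightarrow> 'a) \<Rightarrow> bool" where
  "measure_preserving P T \<longleftrightarrow> T \<in> P \<rightarrow>\<^sub>M P \<and> distr P P T = P"

definition ergodic :: "'a measure \<Rightarrow> ('a \<Rightarrow> 'a) \<Rightarrow> bool" where
  "ergodic P T \<longleftrightarrow>
     (\<forall>A\<in>sets P. T -` A \<inter> space P = A \<longrightarrow> measure P A = 0 \<or> measure P A = 1)"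

text \<open>Law on \<open>S\<^sup>\<nat>\<close> of the time-inhomogeneous Markov chain with initial law \<open>\<mu>\<close> whose transition from
  time \<open>n\<close> to time \<open>n + 1\<close> is \<open>K n\<close>, i.e. the Ionescu-Tulcea limit for the conditional laws
  \<open>\<mu>\<close> at time \<open>0\<close> and \<open>K n (h n)\<close> at time \<open>n + 1\<close> given the history \<open>h\<close>.\<close>

definition markov_law ::
    "'s measure \<Rightarrow> 's measure \<Rightarrow> (nat \<Rightarrow> 's \<Rightarrow> 's measure) \<Rightarrow> (nat \<Rightarrow> 's) measure" where
  "markov_law S \<mu> K =
     projective_family.lim UNIV
       (Ionescu_Tulcea.CI (\<lambda>i h. case i of 0 \<Rightarrow> \<mu> | Suc n \<Rightarrow> K n (h n)) (\<lambda>_. S)) (\<lambda>_. S)"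

definition env_law ::
    "'s measure \<Rightarrow> 's measure \<Rightarrow> ((int \<Rightarrow> 'y) \<times> 's \<Rightarrow> 's measure) \<Rightarrow> (int \<Rightarrow> 'y)
      \<Rightarrow> (nat \<Rightarrow> 's) measure" where
  "env_law S \<mu> K \<omega> = markov_law S \<mu> (\<lambda>n s. K ((seq_shift ^^ n) \<omega>, s))"

definition mixture ::
    "nat \<Rightarrow> 'x measure \<Rightarrow> ('w \<times> 'x \<Rightarrow> real) \<Rightarrow> ('w \<times> 'x \<Rightarrow> 'x measure)
      \<Rightarrow> 'w \<times> (nat \<Rightarrow> 'x) \<Rightarrow> 'x measure" where
  "mixture N X G M = (\<lambda>(\<omega>, x). measure_of (space X) (sets X)
     (\<lambda>A. ennreal ((\<Sum>j<N. G (\<omega>, x j) * measure (M (\<omega>, x j)) A) / (\<Sum>j<N. G (\<omega>, x j)))))"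

definition particle_kernel ::
    "nat \<Rightarrow> 'x measure \<Rightarrow> ('w \<times> 'x \<Rightarrow> real) \<Rightarrow> ('w \<times> 'x \<Rightarrow> 'x measure)
      \<Rightarrow> 'w \<times> (nat \<Rightarrow> 'x) \<Rightarrow> (nat \<Rightarrow> 'x) measure" where
  "particle_kernel N X G M = (\<lambda>(\<omega>, x). PiM {..<N} (\<lambda>i. mixture N X G M (\<omega>, x)))"

definition particle_potential ::
    "nat \<Rightarrow> ('w \<times> 'x \<Rightarrow> real) \<Rightarrow> 'w \<times> (nat \<Rightarrow> 'x) \<Rightarrow> real" where
  "particle_potential N G = (\<lambda>(\<omega>, x). (\<Sum>i<N. G (\<omega>, x i)) / real N)"

definition admissible_kernels ::
    "'w measure \<Rightarrow> 'x measure \<Rightarrow> 'x measure \<Rightarrow> nat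
      \<Rightarrow> ('w \<times> (nat \<Rightarrow> 'x) \<Rightarrow> (nat \<Rightarrow> 'x) measure) set" where
  "admissible_kernels W X \<nu> N =
     {K. K \<in> W \<Otimes>\<^sub>M pow_measure N X \<rightarrow>\<^sub>M prob_algebra (pow_measure N X) \<and>
         (\<exists>em ep \<nu>'. 0 < em \<and> 0 < ep \<and> prob_space \<nu>' \<and> sets \<nu>' = sets (pow_measure N X) \<and>
            (\<forall>\<omega>\<in>space W. \<forall>x\<in>space (pow_measure N X). \<forall>A\<in>sets (pow_measure N X).
               em * measure \<nu>' A \<le> measure (K (\<omega>, x)) A \<and>
               measure (K (\<omega>, x)) A \<le> ep * measure \<nu>' A) \<and>
            absolutely_continuous \<nu>' (pow_measure N \<nu>) \<and>
            (\<integral>\<^sup>+ x. (RN_deriv \<nu>' (pow_measure N \<nu>) x)\<^sup>2 \<partial>\<nu>') < \<infinity>)}"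

text \<open>A jointly measurable \<open>\<phi>\<close> such that \<open>\<phi> (\<omega>, x, \<cdot>)\<close> is a Radon-Nikodym derivative of
  \<open>K (\<omega>, x)\<close> with respect to \<open>K' (\<omega>, x)\<close> for all \<open>(\<omega>, x)\<close>.\<close>

definition RN_version ::
    "'w measure \<Rightarrow> 's measure \<Rightarrow> ('w \<times> 's \<Rightarrow> 's measure) \<Rightarrow> ('w \<times> 's \<Rightarrow> 's measure)
      \<Rightarrow> ('w \<times> 's \<times> 's \<Rightarrow> ennreal) \<Rightarrow> bool" where
  "RN_version W S K' K \<phi> \<longleftrightarrow>
     \<phi> \<in> borel_measurable (W \<Otimes>\<^sub>M (S \<Otimes>\<^sub>M S)) \<and>
     (\<forall>\<omega>\<in>space W. \<forall>x\<in>space S. density (K' (\<omega>, x)) (\<lambda>x'. \<phi> (\<omega>, x, x')) = K (\<omega>, x))"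

text \<open>The expectations of nonnegative functions are taken in \<open>[0, \<infinity>]\<close>.\<close>

definition rel_variance ::
    "nat \<Rightarrow> 'x measure \<Rightarrow> 'x measure \<Rightarrow> ((int \<Rightarrow> 'y) \<times> 'x \<Rightarrow> real)
      \<Rightarrow> ((int \<Rightarrow> 'y) \<times> 'x \<Rightarrow> 'x measure)
      \<Rightarrow> ((int \<Rightarrow> 'y) \<times> (nat \<Rightarrow> 'x) \<Rightarrow> (nat \<Rightarrow> 'x) measure)
      \<Rightarrow> ((int \<Rightarrow> 'y) \<times> (nat \<Rightarrow> 'x) \<times> (nat \<Rightarrow> 'x) \<Rightarrow> ennreal)
      \<Rightarrow> (int \<Rightarrow> 'y) \<Rightarrow> nat \<Rightarrow> ennreal" where
  "rel_variance N X \<mu>0 G M M' \<phi> \<omega> n =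
     (\<integral>\<^sup>+ z. (\<Prod>p<n. (ennreal (particle_potential N G ((seq_shift ^^ p) \<omega>, z p)))\<^sup>2 *
                    (\<phi> ((seq_shift ^^ p) \<omega>, z p, z (Suc p)))\<^sup>2)
        \<partial>env_law (pow_measure N X) (pow_measure N \<mu>0) M' \<omega>) /
     (\<integral>\<^sup>+ x. (\<Prod>p<n. ennreal (G ((seq_shift ^^ p) \<omega>, x p))) \<partial>env_law X \<mu>0 M \<omega>)\<^sup>2"

definition ln_ennreal :: "ennreal \<Rightarrow> ereal" where
  "ln_ennreal x = (if x = 0 then -\<infinity> else if x = \<infinity> then \<infinity> else ereal (ln (enn2real x)))"

end

theory Submission
  imports Defs
begin

text \<open>Numerator and denominator of the relative variance are of the form \<open>\<mu> Q\<^sub>0 \<cdots> Q\<^sub>n\<^sub>-\<^sub>1 1\<close>,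
  where \<open>Q\<^sub>p\<close> is a weighted kernel driven by \<open>\<theta>\<^sup>p \<omega>\<close> with \<open>a \<rho> \<le> Q\<^sub>p(x, \<cdot>) \<le> b \<rho>\<close> for one finite
  nonzero measure \<open>\<rho>\<close>; for the numerator \<open>\<rho>\<close> has density \<open>(d\<nu>\<^sup>\<otimes>\<^sup>N/d\<nu>')\<^sup>2\<close> with respect to the
  reference measure \<open>\<nu>'\<close> of the proposal kernel. Hence \<open>Q\<^sub>0 \<cdots> Q\<^sub>n\<^sub>-\<^sub>1 1(x)\<close> depends on \<open>x\<close> only up to the
  factor \<open>b/a\<close>, so its logarithm is an additive cocycle over the shift up to a bounded error, and the
  ergodic theorem for bounded functions suffices to make its growth rate converge to a constant.
  The limit is the rate of the numerator minus twice the rate of the denominator; it is nonnegative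
  by the Cauchy-Schwarz inequality and the unbiasedness of the particle approximation.\<close>

section \<open>Birkhoff averages and almost additive cocycles\<close>

text \<open>The weight \<open>\<phi>\<close> need not be bounded, so the integrand of the numerator
  admits no pointwise bound; only integrals against it can be controlled. This is why the two-sided
  condition is imposed on one-step operators and tested on all nonnegative measurable functions.
  Square integrability of the density makes \<open>\<rho>\<close> finite, and \<open>\<rho>\<close>
  is nonzero because the product of \<open>N\<close> copies of \<open>\<nu>\<close> has mass one. As
  \<open>N\<close> is fixed, constants raised to the power \<open>N\<close> are harmless. The
  cocycle error is bounded in both directions. Each fixed block length \<open>m\<close> therefore
  determines the growth rate up to \<open>C / m\<close>, and no subadditive ergodic theorem is
  called for. The order of quantifiers matters as well: the limit has to be chosen before the
  initial law and before the version of the density. Comparison with one reference starting point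
  yields a single null set for all initial laws; uniqueness of densities almost everywhere removes
  the dependence on the version.\<close>

lemma measure_preserving_integral:
  fixes f :: "'a \<Rightarrow> real"
  assumes "measure_preserving P T" and "f \<in> borel_measurable P"
  shows "(\<integral>x. f (T x) \<partial>P) = (\<integral>x. f x \<partial>P)"
proof -
  have T: "T \<in> P \<rightarrow>\<^sub>M P" and d: "distr P P T = P"
    using assms(1) by (auto simp: measure_preserving_def)
  have "(\<integral>x. f x \<partial>P) = (\<integral>x. f x \<partial>distr P P T)" by (simp add: d)
  also have "\<dots> = (\<integral>x. f (T x) \<partial>P)"
    by (rule integral_distr[OF T assms(2)])
  finally show ?thesis ..
qed

lemma measurable_funpow_self:
  "T \<in> P \<rightarrow>\<^sub>M P \<Longrightarrow> (T ^^ n) \<in> P \<rightarrow>\<^sub>M P"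
  by (induction n) (auto simp: o_def)

section \<open>Maximal inequality and pointwise ergodic theorem for bounded functions\<close>

definition birkhoff_sum :: "('a \<Rightarrow> 'a) \<Rightarrow> ('a \<Rightarrow> real) \<Rightarrow> nat \<Rightarrow> 'a \<Rightarrow> real" where
  "birkhoff_sum T f n x = (\<Sum>j<n. f ((T ^^ j) x))"

lemma birkhoff_sum_0[simp]: "birkhoff_sum T f 0 x = 0"
  by (simp add: birkhoff_sum_def)

lemma birkhoff_sum_Suc: "birkhoff_sum T f (Suc n) x = f x + birkhoff_sum T f n (T x)"
  unfolding birkhoff_sum_def by (subst sum.lessThan_Suc_shift) (simp add: funpow_swap1)

lemma measurable_birkhoff_sum[measurable (raw)]:
  assumes "T \<in> P \<rightarrow>\<^sub>M P" "f \<in> borel_measurable P"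
  shows "birkhoff_sum T f n \<in> borel_measurable P"
proof -
  have [measurable]: "(T ^^ j) \<in> P \<rightarrow>\<^sub>M P" for j by (rule measurable_funpow_self[OF assms(1)])
  note assms(2)[measurable]
  show ?thesis unfolding birkhoff_sum_def[abs_def] by measurable
qed

text \<open>Garsia's argument: the running maxima increase in \<open>n\<close> and \<open>T\<close>
  preserves integrals, so \<open>F (Suc n) - F n \<circ> T\<close> has nonnegative integral, and
  this difference is at most \<open>f\<close> restricted to \<open>?A n\<close>. The hypothesis
  \<open>pos\<close> makes the sets \<open>?A n\<close> exhaust almost the whole space, and the
  bound \<open>B\<close> allows passing to the limit.\<close>

lemma maximal_ergodic:
  fixes f :: "'a \<Rightarrow> real"
  assumes "prob_space P" and mp: "measure_preserving P T"
    and f[measurable]: "f \<in> borel_measurable P"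
    and B: "\<And>x. x \<in> space P \<Longrightarrow> \<bar>f x\<bar> \<le> B"
    and pos: "AE x in P. \<exists>n. 0 < birkhoff_sum T f n x"
  shows "0 \<le> (\<integral>x. f x \<partial>P)"
proof -
  interpret prob_space P by fact
  have T[measurable]: "T \<in> P \<rightarrow>\<^sub>M P" using mp by (auto simp: measure_preserving_def)
  have Tsp: "x \<in> space P \<Longrightarrow> T x \<in> space P" for x using measurable_space[OF T] .
  \<comment> \<open>\<open>F n\<close> is the maximum of the Birkhoff sums of lengths \<open>0, \<dots>, n\<close>.\<close>
  define F where "F n = rec_nat (\<lambda>x. 0) (\<lambda>_ g x. max 0 (f x + g (T x))) n" for n
  have F0[simp]: "F 0 x = 0" for x by (simp add: F_def)
  have FS: "F (Suc n) x = max 0 (f x + F n (T x))" for n x by (simp add: F_def)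
  have F_nonneg: "0 \<le> F n x" for n x by (cases n) (auto simp: FS)
  have F_mono: "F n x \<le> F (Suc n) x" for n x
    by (induction n arbitrary: x) (auto simp: FS F_nonneg intro: max.coboundedI2)
  have F_ge: "birkhoff_sum T f n x \<le> F n x" for n x
    by (induction n arbitrary: x) (auto simp: FS birkhoff_sum_Suc intro: max.coboundedI2)
  have Fm[measurable]: "F n \<in> borel_measurable P" for n
  proof (induction n)
    case (Suc n)
    note Suc[measurable]
    show ?case unfolding FS[abs_def] by measurable
  qed (simp add: F_def)
  have F_bd: "x \<in> space P \<Longrightarrow> \<bar>F n x\<bar> \<le> real n * B" for n x
  proof (induction n arbitrary: x)
    case (Suc n)
    have "\<bar>F n (T x)\<bar> \<le> real n * B" using Suc Tsp by blast
    with B[OF Suc.prems] F_nonneg[of n "T x"] show ?case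
      by (auto simp: FS algebra_simps abs_le_iff)
  qed simp
  have Fint: "integrable P (F n)" for n
    by (rule integrable_const_bound[where B="real n * B"]) (auto simp: F_bd)
  have FTint: "integrable P (\<lambda>x. F n (T x))" for n
    by (rule integrable_const_bound[where B="real n * B"]) (auto simp: F_bd Tsp)
  let ?A = "\<lambda>n. {x \<in> space P. 0 < F (Suc n) x}"
  let ?g = "\<lambda>n x. f x * indicator (?A n) x"
  have gint: "integrable P (?g n)" for n
  proof (rule integrable_const_bound[where B=B])
    have "0 \<le> B" if "x \<in> space P" for x using B[OF that] by linarith
    then show "AE x in P. norm (?g n x) \<le> B" using B by (auto simp: indicator_def)
  qed measurable
  have "0 \<le> (\<integral>x. ?g n x \<partial>P)" for n
  proof -
    have "0 = (\<integral>x. F n x \<partial>P) - (\<integral>x. F n (T x) \<partial>P)"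
      by (simp add: measure_preserving_integral[OF mp Fm])
    also have "\<dots> \<le> (\<integral>x. F (Suc n) x \<partial>P) - (\<integral>x. F n (T x) \<partial>P)"
      using integral_mono[OF Fint Fint F_mono] by simp
    also have "\<dots> = (\<integral>x. F (Suc n) x - F n (T x) \<partial>P)"
      by (rule Bochner_Integration.integral_diff[symmetric, OF Fint FTint])
    also have "\<dots> \<le> (\<integral>x. ?g n x \<partial>P)"
    proof (rule integral_mono)
      show "integrable P (\<lambda>x. F (Suc n) x - F n (T x))" using Fint FTint by auto
      \<comment> \<open>Where \<open>F (Suc n) x\<close> is positive, the maximum is attained by
        \<open>f x + F n (T x)\<close> and equality holds; elsewhere the left side is
        \<open>- F n (T x)\<close>, which is at most 0.\<close>
      show "F (Suc n) x - F n (T x) \<le> ?g n x" if "x \<in> space P" for x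
        using F_nonneg[of n "T x"] that by (auto simp: FS indicator_def)
    qed (rule gint)
    finally show ?thesis .
  qed
  moreover have "(\<lambda>n. \<integral>x. ?g n x \<partial>P) \<longlonglongrightarrow> (\<integral>x. f x \<partial>P)"
  proof (rule integral_dominated_convergence[where w="\<lambda>_. B"])
    show "AE x in P. (\<lambda>n. ?g n x) \<longlonglongrightarrow> f x"
      using pos AE_space
    proof eventually_elim
      case (elim x)
      then obtain n where n: "0 < birkhoff_sum T f n x" by auto
      have "0 < F m x" if "n \<le> m" for m
        using n F_ge[of n x] lift_Suc_mono_le[of "\<lambda>n. F n x", OF F_mono that] by linarith
      then have "\<forall>\<^sub>F m in sequentially. ?g m x = f x"
        using elim(2) by (intro eventually_sequentiallyI[of n]) (auto simp: indicator_def)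
      then show ?case by (rule tendsto_eventually)
    qed
    show "AE x in P. norm (?g n x) \<le> B" for n
      using AE_space
    proof eventually_elim
      case (elim x)
      from B[OF elim] show ?case by (auto simp: indicator_def)
    qed
  qed auto
  ultimately show ?thesis by (intro LIMSEQ_le_const) auto
qed

text \<open>Unboundedness above of the sums is unaffected by dropping the first term
  \<open>f x\<close>, so this event is strictly invariant and has probability 0 or 1. Probability 1
  would force a nonnegative mean by the maximal inequality.\<close>

lemma birkhoff_sum_bounded_above:
  fixes f :: "'a \<Rightarrow> real"
  assumes "prob_space P" and mp: "measure_preserving P T" and erg: "ergodic P T"
    and f[measurable]: "f \<in> borel_measurable P"
    and B: "\<And>x. x \<in> space P \<Longrightarrow> \<bar>f x\<bar> \<le> B"
    and neg: "(\<integral>x. f x \<partial>P) < 0"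
  shows "AE x in P. \<exists>K. \<forall>n. birkhoff_sum T f n x \<le> real K"
proof -
  interpret prob_space P by fact
  have T[measurable]: "T \<in> P \<rightarrow>\<^sub>M P" using mp by (auto simp: measure_preserving_def)
  define A where "A = {x \<in> space P. \<forall>K::nat. \<exists>n. real K < birkhoff_sum T f n x}"
  have A[measurable]: "A \<in> sets P" unfolding A_def by measurable
  have eq: "(\<forall>K::nat. \<exists>n. real K < birkhoff_sum T f n (T x))
      \<longleftrightarrow> (\<forall>K::nat. \<exists>n. real K < birkhoff_sum T f n x)" for x
  proof safe
    fix K :: nat
    assume *: "\<forall>K::nat. \<exists>n. real K < birkhoff_sum T f n (T x)"
    obtain L :: nat where "\<bar>f x\<bar> \<le> real L" using real_arch_simple by blast
    moreover obtain n where "real (K + L) < birkhoff_sum T f n (T x)" using * by blast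
    ultimately have "real K < birkhoff_sum T f (Suc n) x" by (simp add: birkhoff_sum_Suc)
    then show "\<exists>n. real K < birkhoff_sum T f n x" ..
  next
    fix K :: nat
    assume *: "\<forall>K::nat. \<exists>n. real K < birkhoff_sum T f n x"
    obtain L :: nat where L: "\<bar>f x\<bar> \<le> real L" using real_arch_simple by blast
    obtain n where n: "real (K + L) < birkhoff_sum T f n x" using * by blast
    \<comment> \<open>The empty sum is 0 and cannot exceed the nonnegative threshold, which excludes
      \<open>n = 0\<close>.\<close>
    then obtain m where "n = Suc m" by (cases n) auto
    with n L have "real K < birkhoff_sum T f m (T x)" by (simp add: birkhoff_sum_Suc)
    then show "\<exists>n. real K < birkhoff_sum T f n (T x)" ..
  qed
  have "T -` A \<inter> space P = A" using measurable_space[OF T] by (auto simp: A_def eq)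
  then consider "prob A = 0" | "prob A = 1" using erg A unfolding ergodic_def by blast
  then show ?thesis
  proof cases
    case 1
    then have "AE x in P. x \<notin> A" using A by (simp add: AE_iff_measurable[OF _ refl] prob_eq_0)
    then show ?thesis by (auto simp: A_def not_less)
  next
    case 2
    then have "AE x in P. x \<in> A" using prob_eq_1 A by blast
    then have "AE x in P. \<exists>n. 0 < birkhoff_sum T f n x"
      by eventually_elim (force simp: A_def dest: spec[of _ 0])
    from maximal_ergodic[OF assms(1) mp f B this] neg show ?thesis by linarith
  qed
qed

text \<open>Subtracting the mean plus \<open>e / 2\<close> leaves a function of mean
  \<open>- e / 2\<close>, whose sums are bounded above along almost every orbit. That bound, divided
  by \<open>n\<close>, is eventually absorbed by the other \<open>e / 2\<close>.\<close>

lemma birkhoff_eventually_upper: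
  fixes f :: "'a \<Rightarrow> real"
  assumes "prob_space P" and mp: "measure_preserving P T" and erg: "ergodic P T"
    and f[measurable]: "f \<in> borel_measurable P"
    and B: "\<And>x. x \<in> space P \<Longrightarrow> \<bar>f x\<bar> \<le> B" and e: "0 < e"
  shows "AE x in P. \<forall>\<^sub>F n in sequentially. birkhoff_sum T f n x / real n \<le> (\<integral>x. f x \<partial>P) + e"
proof -
  interpret prob_space P by fact
  let ?c = "(\<integral>x. f x \<partial>P) + e / 2"
  have [simp]: "integrable P f" by (rule integrable_const_bound[where B=B]) (auto simp: B)
  have eq: "birkhoff_sum T (\<lambda>x. f x - c) n x = birkhoff_sum T f n x - real n * c" for c n x
    by (simp add: birkhoff_sum_def sum_subtractf)
  have "AE x in P. \<exists>K. \<forall>n. birkhoff_sum T (\<lambda>x. f x - ?c) n x \<le> real K"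
  proof (rule birkhoff_sum_bounded_above[OF assms(1) mp erg])
    show "\<bar>f x - ?c\<bar> \<le> B + \<bar>?c\<bar>" if "x \<in> space P" for x
      using B[OF that] abs_triangle_ineq4[of "f x" ?c] by linarith
    show "(\<integral>x. f x - ?c \<partial>P) < 0" using e by (simp add: prob_space)
  qed measurable
  then show ?thesis
  proof eventually_elim
    case (elim x)
    then obtain K where K: "birkhoff_sum T f n x \<le> real n * ?c + real K" for n
      unfolding eq by (force simp: algebra_simps)
    obtain m :: nat where m: "real K / (e / 2) < real m" using reals_Archimedean2 by blast
    show ?case
    proof (rule eventually_sequentiallyI[of "Suc m"])
      fix n assume n: "Suc m \<le> n"
      have "real K \<le> (e/2) * real m" using m e by (simp add: field_simps)
      also have "\<dots> \<le> (e/2) * real n" using n e by (intro mult_left_mono) auto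
      finally have "birkhoff_sum T f n x \<le> real n * (?c + e/2)" using K[of n] by (simp add: algebra_simps)
      then show "birkhoff_sum T f n x / real n \<le> (\<integral>x. f x \<partial>P) + e"
        using n by (simp add: field_simps)
    qed
  qed
qed

text \<open>The lower estimate is the upper one for \<open>- f\<close>. Restricting the tolerance to
  the countably many values \<open>inverse (real (Suc k))\<close> leaves one null set.\<close>

theorem birkhoff_bounded:
  fixes f :: "'a \<Rightarrow> real"
  assumes "prob_space P" and "measure_preserving P T" and "ergodic P T"
    and f[measurable]: "f \<in> borel_measurable P"
    and B: "\<And>x. x \<in> space P \<Longrightarrow> \<bar>f x\<bar> \<le> B"
  shows "AE x in P. (\<lambda>n. birkhoff_sum T f n x / real n) \<longlonglongrightarrow> (\<integral>x. f x \<partial>P)"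
proof -
  let ?I = "\<integral>x. f x \<partial>P"
  have neg: "birkhoff_sum T (\<lambda>x. - f x) n x = - birkhoff_sum T f n x" for n x
    by (simp add: birkhoff_sum_def sum_negf)
  have "AE x in P. \<forall>k::nat. \<forall>\<^sub>F n in sequentially. birkhoff_sum T f n x / real n \<le> ?I + inverse (real (Suc k))"
    unfolding AE_all_countable using birkhoff_eventually_upper[OF assms] by auto
  moreover have "AE x in P. \<forall>k::nat. \<forall>\<^sub>F n in sequentially.
      birkhoff_sum T (\<lambda>x. - f x) n x / real n \<le> (\<integral>x. - f x \<partial>P) + inverse (real (Suc k))"
    unfolding AE_all_countable using birkhoff_eventually_upper[OF assms(1-3), of "\<lambda>x. - f x" B] B by auto
  ultimately show ?thesis
  proof eventually_elim
    case (elim x)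
    show ?case
    proof (rule tendstoI)
      fix e :: real assume "0 < e"
      then obtain k where k: "inverse (real (Suc k)) < e" using reals_Archimedean by blast
      show "\<forall>\<^sub>F n in sequentially. dist (birkhoff_sum T f n x / real n) ?I < e"
        using elim(1)[rule_format, of k] elim(2)[rule_format, of k]
        by eventually_elim (use k in \<open>auto simp: dist_real_def neg\<close>)
    qed
  qed
qed

text \<open>Telescoping \<open>u m (T\<^sup>j x) \<approx> u (j + m) x - u j x\<close> over \<open>j < n\<close> compares \<open>m * u n\<close> with a
  Birkhoff sum of \<open>u m\<close>.\<close>

lemma almost_additive_birkhoff:
  fixes u :: "nat \<Rightarrow> 'a \<Rightarrow> real"
  assumes aa: "\<And>m n x. x \<in> S \<Longrightarrow> \<bar>u (m + n) x - u m x - u n ((T ^^ m) x)\<bar> \<le> C"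
    and bd: "\<And>n x. x \<in> S \<Longrightarrow> \<bar>u n x\<bar> \<le> D n"
    and T: "\<And>n x. x \<in> S \<Longrightarrow> (T ^^ n) x \<in> S" and x: "x \<in> S"
  shows "\<bar>real m * u n x - birkhoff_sum T (u m) n x\<bar> \<le> real n * C + (real m * C + 2 * (\<Sum>i<m. D i))"
proof -
  have "birkhoff_sum T (u m) n x - (\<Sum>j<n. u (j + m) x - u j x) = (\<Sum>j<n. u m ((T ^^ j) x) - u (j + m) x + u j x)"
    by (simp add: birkhoff_sum_def sum_subtractf sum.distrib)
  also have "\<bar>\<dots>\<bar> \<le> (\<Sum>j<n. C)"
    by (rule order_trans[OF sum_abs sum_mono]) (use aa[OF x, of _ m] in \<open>simp add: abs_le_iff algebra_simps\<close>)
  finally have 1: "\<bar>birkhoff_sum T (u m) n x - (\<Sum>j<n. u (j + m) x - u j x)\<bar> \<le> real n * C" by simp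
  \<comment> \<open>This exchanges the number of terms with the length of the increments. Only
    \<open>m\<close> terms remain, so replacing each \<open>u (n + i) x\<close> by
    \<open>u n x\<close> costs an error that does not grow with \<open>n\<close>.\<close>
  have tele: "(\<Sum>j<n. u (j + m) x - u j x) = (\<Sum>i<m. u (n + i) x - u i x)"
  proof (induction n)
    case (Suc n)
    have "(\<Sum>i<m. u (Suc n + i) x - u i x) - (\<Sum>i<m. u (n + i) x - u i x) = (\<Sum>i<m. u (n + Suc i) x - u (n + i) x)"
      by (simp add: sum_subtractf)
    also have "\<dots> = u (n + m) x - u n x" using sum_lessThan_telescope[of "\<lambda>i. u (n + i) x" m] by simp
    finally show ?case using Suc by simp
  qed simp
  have "(\<Sum>i<m. u (n + i) x - u i x) - real m * u n x = (\<Sum>i<m. u (n + i) x - u i x - u n x)"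
    by (simp add: sum_subtractf)
  also have "\<bar>\<dots>\<bar> \<le> (\<Sum>i<m. C + 2 * D i)"
  proof (rule order_trans[OF sum_abs sum_mono])
    show "\<bar>u (n + i) x - u i x - u n x\<bar> \<le> C + 2 * D i" for i
      using aa[OF x, of n i] bd[OF x, of i] bd[OF T[OF x], of i n] by linarith
  qed
  finally show ?thesis using 1 unfolding tele by (simp add: sum.distrib sum_distrib_left)
qed

text \<open>For each fixed \<open>m\<close> the ergodic theorem applied to \<open>u m\<close>
  confines \<open>u n x / n\<close> asymptotically to within \<open>C / m\<close> of
  \<open>c m / m\<close>. Letting \<open>m\<close> grow gives the Cauchy property, and the limit is
  constant because it is also the limit of the deterministic sequence
  \<open>c m / m\<close>.\<close>

theorem almost_additive_ergodic:
  fixes u :: "nat \<Rightarrow> 'a \<Rightarrow> real"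
  assumes "prob_space P" and mp: "measure_preserving P T" and "ergodic P T"
    and um: "\<And>n. u n \<in> borel_measurable P"
    and aa: "\<And>m n x. x \<in> space P \<Longrightarrow> \<bar>u (m + n) x - u m x - u n ((T ^^ m) x)\<bar> \<le> C"
    and bd: "\<And>n x. x \<in> space P \<Longrightarrow> \<bar>u n x\<bar> \<le> D n"
  shows "\<exists>L. AE x in P. (\<lambda>n. u n x / real n) \<longlonglongrightarrow> L"
proof -
  interpret prob_space P by fact
  have T: "T \<in> P \<rightarrow>\<^sub>M P" using mp by (auto simp: measure_preserving_def)
  have Tsp: "x \<in> space P \<Longrightarrow> (T ^^ n) x \<in> space P" for x n
    using measurable_space[OF measurable_funpow_self[OF T]] .
  define c where "c m = (\<integral>x. u m x \<partial>P)" for m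
  have C: "0 \<le> C" using aa[of _ 0 0] not_empty by fastforce
  \<comment> \<open>Collects, for all block lengths at once, what is needed of a single orbit; the
    rest of the argument is deterministic.\<close>
  define good where "good x \<longleftrightarrow> (\<forall>m e. 0 < m \<longrightarrow> 0 < e \<longrightarrow>
     (\<forall>\<^sub>F n in sequentially. \<bar>u n x / real n - c m / real m\<bar> \<le> C / real m + e))" for x
  have "AE x in P. \<forall>m. (\<lambda>n. birkhoff_sum T (u m) n x / real n) \<longlonglongrightarrow> c m"
    unfolding AE_all_countable c_def
    using birkhoff_bounded[OF assms(1-3) um bd] by auto
  then have good: "AE x in P. good x"
    using AE_space
  proof eventually_elim
    case (elim x)
    show ?case unfolding good_def
    proof safe
      fix m :: nat and e :: real assume m: "0 < m" and e: "0 < e"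
      define K where "K = real m * C + 2 * (\<Sum>i<m. D i)"
      have "(\<lambda>n. \<bar>birkhoff_sum T (u m) n x / real n - c m\<bar> + K / real n) \<longlonglongrightarrow> \<bar>c m - c m\<bar> + 0"
        by (intro tendsto_intros elim(1)[rule_format] lim_const_over_n)
      then have "\<forall>\<^sub>F n in sequentially. \<bar>birkhoff_sum T (u m) n x / real n - c m\<bar> + K / real n < e * real m"
        using m e by (intro order_tendstoD(2)) auto
      then show "\<forall>\<^sub>F n in sequentially. \<bar>u n x / real n - c m / real m\<bar> \<le> C / real m + e"
        using eventually_gt_at_top[of 0]
      proof eventually_elim
        case n: (elim n)
        let ?b = "birkhoff_sum T (u m) n x"
        have "\<bar>real m * u n x - ?b\<bar> \<le> real n * C + K"
          unfolding K_def by (rule almost_additive_birkhoff[OF aa bd Tsp elim(2)])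
        then have "\<bar>real m * u n x - ?b\<bar> / real n \<le> C + K / real n"
          using n by (simp add: field_simps)
        then have "\<bar>real m * u n x / real n - ?b / real n\<bar> \<le> C + K / real n"
          by (simp add: diff_divide_distrib[symmetric])
        with n have "\<bar>real m * u n x / real n - c m\<bar> \<le> C + e * real m" by linarith
        then have "\<bar>real m * u n x / real n - c m\<bar> / real m \<le> C / real m + e" using m by (simp add: field_simps)
        moreover have "u n x / real n - c m / real m = (real m * u n x / real n - c m) / real m"
          using m by (simp add: field_simps)
        ultimately show ?case using m by (simp add: abs_divide)
      qed
    qed
  qed
  have Cm: "(\<lambda>m. C / real m) \<longlonglongrightarrow> 0" by (rule lim_const_over_n)
  have good_lim: "\<exists>L. (\<lambda>n. u n x / real n) \<longlonglongrightarrow> L \<and> (\<lambda>m. c m / real m) \<longlonglongrightarrow> L" if "good x" for x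
  proof -
    have "Cauchy (\<lambda>n. u n x / real n)"
    proof (rule metric_CauchyI)
      fix e :: real assume e: "0 < e"
      have "\<forall>\<^sub>F m in sequentially. C / real m < e / 4 \<and> 0 < m"
        using order_tendstoD(2)[OF Cm, of "e/4"] e eventually_gt_at_top[of 0] by (simp add: eventually_conj)
      then obtain m where m: "C / real m < e / 4" "0 < m" by (auto dest: eventually_happens)
      have "0 < e / 4" using e by simp
      with \<open>good x\<close> m(2) obtain K where K: "n \<ge> K \<Longrightarrow> \<bar>u n x / real n - c m / real m\<bar> \<le> C / real m + e / 4" for n
        unfolding good_def eventually_sequentially by meson
      show "\<exists>K. \<forall>i\<ge>K. \<forall>j\<ge>K. dist (u i x / real i) (u j x / real j) < e"
      proof (intro exI allI impI)
        fix i j assume "K \<le> i" "K \<le> j"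
        with K[of i] K[of j] m(1) show "dist (u i x / real i) (u j x / real j) < e"
          unfolding dist_real_def by linarith
      qed
    qed
    then obtain L where L: "(\<lambda>n. u n x / real n) \<longlonglongrightarrow> L"
      using Cauchy_convergent convergent_def by blast
    \<comment> \<open>Letting \<open>n\<close> tend to infinity for fixed \<open>m\<close> shows
      that the orbit's limit is the limit of \<open>c m / m\<close>, hence the same for all good
      points.\<close>
    have "\<bar>L - c m / real m\<bar> \<le> C / real m" if "0 < m" for m
    proof (rule field_le_epsilon)
      fix e :: real assume "0 < e"
      with \<open>good x\<close> that have ev: "\<forall>\<^sub>F n in sequentially. \<bar>u n x / real n - c m / real m\<bar> \<le> C / real m + e"
        unfolding good_def by blast
      show "\<bar>L - c m / real m\<bar> \<le> C / real m + e"
        by (rule tendsto_upperbound[OF _ ev]) (auto intro!: tendsto_intros L)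
    qed
    then have "\<forall>\<^sub>F m in sequentially. norm (c m / real m - L) \<le> C / real m"
      by (intro eventually_sequentiallyI[of 1]) (auto simp: abs_minus_commute)
    then have "(\<lambda>m. c m / real m - L) \<longlonglongrightarrow> 0" using Cm by (rule Lim_null_comparison)
    with L show ?thesis by (auto dest: Lim_null[THEN iffD2])
  qed
  show ?thesis
  proof (cases "\<exists>x. good x")
    case True
    then obtain x0 where "good x0" ..
    from good_lim[OF this] obtain L where L: "(\<lambda>m. c m / real m) \<longlonglongrightarrow> L" by blast
    have "(\<lambda>n. u n x / real n) \<longlonglongrightarrow> L" if "good x" for x
      using good_lim[OF that] LIMSEQ_unique[OF L] by blast
    then show ?thesis using good by (intro exI[of _ L]) (auto elim: eventually_mono)
  next
    \<comment> \<open>Here the almost sure validity of \<open>good\<close> means that almost every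
      point satisfies a false statement, so any conclusion follows.\<close>
    case False
    then show ?thesis using good by (auto elim!: eventually_mono)
  qed
qed

section \<open>Time-inhomogeneous Markov chains\<close>

text \<open>The marginals of the projective limit are given by \<open>C\<close> up to the stage
  \<open>up_to J\<close>. For an initial segment this stage is \<open>n\<close> itself, and
  restriction to the segment is the identity on the space of \<open>C 0 n\<close>. The construction
  starts from the empty history, encoded by the everywhere undefined function.\<close>

lemma nn_integral_Ionescu_Tulcea_lim:
  assumes "Ionescu_Tulcea \<kappa> A" and F: "F \<in> borel_measurable (PiM {0..<n} A)"
  shows "(\<integral>\<^sup>+z. F (restrict z {0..<n}) \<partial>projective_family.lim UNIV (Ionescu_Tulcea.CI \<kappa> A) A)
    = (\<integral>\<^sup>+h. F h \<partial>Ionescu_Tulcea.C \<kappa> A 0 n (\<lambda>_. undefined))"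
proof -
  interpret Ionescu_Tulcea \<kappa> A by fact
  let ?J = "{0..<n}"
  have up: "up_to ?J = n"
    using up_to[of ?J] up_to_iff_Ico[of ?J n] by (intro antisym) auto
  have u: "(\<lambda>x. undefined) \<in> space (PiM {0..<0::nat} A)" by simp
  have sC: "sets (C 0 n (\<lambda>x. undefined)) = sets (PiM ?J A)" using sets_C[OF u, of n] by simp
  have spC: "space (C 0 n (\<lambda>x. undefined)) = space (PiM ?J A)" using space_C[OF u, of n] by simp
  have "(\<integral>\<^sup>+z. F (restrict z ?J) \<partial>PF.lim) = (\<integral>\<^sup>+h. F h \<partial>distr PF.lim (PiM ?J A) (\<lambda>z. restrict z ?J))"
    by (rule nn_integral_distr[symmetric])
       (simp_all add: F measurable_cong_sets[OF PF.sets_lim refl] measurable_restrict_subset del: restrict_apply)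
  also have "\<dots> = (\<integral>\<^sup>+h. F h \<partial>distr (C 0 n (\<lambda>x. undefined)) (PiM ?J A) (\<lambda>z. restrict z ?J))"
    by (simp add: distr_lim CI_def up)
  also have "\<dots> = (\<integral>\<^sup>+h. F (restrict h ?J) \<partial>C 0 n (\<lambda>x. undefined))"
    by (rule nn_integral_distr)
       (simp_all add: F measurable_cong_sets[OF sC refl] measurable_restrict_subset del: restrict_apply)
  also have "\<dots> = (\<integral>\<^sup>+h. F h \<partial>C 0 n (\<lambda>x. undefined))"
    by (rule nn_integral_cong) (auto simp: spC space_PiM)
  finally show ?thesis .
qed

text \<open>The composition \<open>Q 0 (Q 1 (... (Q (n - 1) f)))\<close>. The recursion peels off
  the operator of the latest time, to match integration over the last state of the chain.\<close>

primrec backward :: "(nat \<Rightarrow> ('s \<Rightarrow> ennreal) \<Rightarrow> 's \<Rightarrow> ennreal) \<Rightarrow> nat \<Rightarrow> ('s \<Rightarrow> ennreal) \<Rightarrow> 's \<Rightarrow> ennreal" where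
  "backward Q 0 f = f"
| "backward Q (Suc n) f = backward Q n (Q n f)"

text \<open>Given the history, the last state has law \<open>K n (h n)\<close>; integrating it out
  turns the terminal function \<open>f\<close> into \<open>?Q n f\<close> with the horizon shortened
  by one. Integrals in \<open>ennreal\<close> make integrability conditions unnecessary.\<close>

lemma nn_integral_markov_law:
  fixes S :: "'s measure"
  assumes \<mu>: "prob_space \<mu>" "sets \<mu> = sets S"
    and K: "\<And>n. K n \<in> S \<rightarrow>\<^sub>M prob_algebra S"
    and w: "\<And>n. w n \<in> borel_measurable (S \<Otimes>\<^sub>M S)"
    and f: "f \<in> borel_measurable S"
  shows "(\<integral>\<^sup>+z. (\<Prod>p<n. w p (z p, z (Suc p))) * f (z n) \<partial>markov_law S \<mu> K)
    = (\<integral>\<^sup>+x. backward (\<lambda>p g x. \<integral>\<^sup>+y. w p (x, y) * g y \<partial>K p x) n f x \<partial>\<mu>)"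
proof -
  let ?\<kappa> = "\<lambda>i h. case i of 0 \<Rightarrow> \<mu> | Suc n \<Rightarrow> K n (h n)"
  let ?Q = "\<lambda>p g x. \<integral>\<^sup>+y. w p (x, y) * g y \<partial>K p x"
  note K'[measurable] = measurable_prob_algebraD[OF K]
  note w[measurable]
  have \<mu>S: "\<mu> \<in> space (prob_algebra S)" using \<mu> by (simp add: space_prob_algebra)
  have \<kappa>: "?\<kappa> i \<in> PiM {0..<i} (\<lambda>_. S) \<rightarrow>\<^sub>M prob_algebra S" for i
  proof (cases i)
    case 0 then show ?thesis using \<mu>S by simp
  next
    case (Suc n)
    have "(\<lambda>h. K n (h n)) \<in> PiM {0..<Suc n} (\<lambda>_. S) \<rightarrow>\<^sub>M prob_algebra S"
      by (rule measurable_compose[OF _ K]) simp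
    then show ?thesis using Suc by simp
  qed
  have IT: "Ionescu_Tulcea ?\<kappa> (\<lambda>_. S)"
    using measurable_prob_algebraD[OF \<kappa>] measurable_space[OF \<kappa>]
    by (intro Ionescu_Tulcea.intro) (auto simp: space_prob_algebra)
  interpret Ionescu_Tulcea ?\<kappa> "\<lambda>_. S" by (rule IT)
  have Fm: "(\<lambda>h. (\<Prod>p<n. w p (h p, h (Suc p))) * f (h n)) \<in> borel_measurable (PiM {0..<Suc n} (\<lambda>_. S))"
    if [measurable]: "f \<in> borel_measurable S" for f n
    by (intro borel_measurable_times_ennreal borel_measurable_prod_ennreal measurable_compose[OF _ w] measurable_Pair
          measurable_compose[OF _ that] measurable_component_singleton) auto
  have u: "(\<lambda>x. undefined) \<in> space (PiM {0..<0::nat} (\<lambda>_. S))" by simp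
  \<comment> \<open>A horizon of \<open>n\<close> transitions involves the coordinates
    \<open>0\<close> to \<open>n\<close>, hence stage \<open>Suc n\<close>. The function
    \<open>f\<close> stays arbitrary in the induction because every step changes it.\<close>
  have "(\<integral>\<^sup>+h. (\<Prod>p<n. w p (h p, h (Suc p))) * f (h n) \<partial>C 0 (Suc n) (\<lambda>_. undefined))
      = (\<integral>\<^sup>+x. backward ?Q n f x \<partial>\<mu>)"
    using f
  proof (induction n arbitrary: f)
    case 0
    note 0[measurable]
    have "(\<integral>\<^sup>+h. f (h 0) \<partial>C 0 (Suc 0) (\<lambda>_. undefined)) = (\<integral>\<^sup>+h. f (h 0) \<partial>eP 0 (\<lambda>_. undefined))"
      using bind_return[OF measurable_eP u] by simp
    also have "\<dots> = (\<integral>\<^sup>+x. f x \<partial>\<mu>)"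
      by (subst nn_integral_eP) (auto simp: u intro!: measurable_compose[OF _ 0])
    finally show ?case by simp
  next
    case (Suc n)
    note Suc.prems[measurable]
    let ?F = "\<lambda>h. (\<Prod>p<Suc n. w p (h p, h (Suc p))) * f (h (Suc n))"
    have Qf: "?Q n f \<in> borel_measurable S"
      by (rule nn_integral_measurable_subprob_algebra2[where N=S]) measurable
    have "(\<integral>\<^sup>+h. ?F h \<partial>C 0 (Suc (Suc n)) (\<lambda>_. undefined))
        = (\<integral>\<^sup>+h. \<integral>\<^sup>+z. ?F z \<partial>eP (Suc n) h \<partial>C 0 (Suc n) (\<lambda>_. undefined))"
      unfolding C.simps(2)[of 0 "Suc n"] add_0
    proof (rule nn_integral_bind[OF Fm[OF Suc.prems]])
      show "eP (Suc n) \<in> C 0 (Suc n) (\<lambda>_. undefined) \<rightarrow>\<^sub>M subprob_algebra (PiM {0..<Suc (Suc n)} (\<lambda>_. S))"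
        using sets_C[OF u, of "Suc n"] measurable_eP[of "Suc n"] by (simp cong: measurable_cong_sets)
    qed
    also have "\<dots> = (\<integral>\<^sup>+h. (\<Prod>p<n. w p (h p, h (Suc p))) * ?Q n f (h n) \<partial>C 0 (Suc n) (\<lambda>_. undefined))"
    proof (rule nn_integral_cong)
      fix h assume "h \<in> space (C 0 (Suc n) (\<lambda>_. undefined))"
      then have h: "h \<in> space (PiM {0..<Suc n} (\<lambda>_. S))" using space_C[OF u, of "Suc n"] by simp
      then have hn: "h n \<in> space S" by (auto simp: space_PiM)
      have [measurable_cong]: "sets (K n (h n)) = sets S"
        using measurable_space[OF K hn] by (simp add: space_prob_algebra)
      have "(\<integral>\<^sup>+z. ?F z \<partial>eP (Suc n) h) = (\<integral>\<^sup>+y. ?F (h(Suc n := y)) \<partial>K n (h n))"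
        using nn_integral_eP[OF h Fm[OF Suc.prems]] by simp
      also have "\<dots> = (\<integral>\<^sup>+y. (\<Prod>p<n. w p (h p, h (Suc p))) * (w n (h n, y) * f y) \<partial>K n (h n))"
        by (intro nn_integral_cong) (simp add: mult.assoc)
      also have "\<dots> = (\<Prod>p<n. w p (h p, h (Suc p))) * ?Q n f (h n)"
        using hn by (intro nn_integral_cmult) measurable
      finally show "(\<integral>\<^sup>+z. ?F z \<partial>eP (Suc n) h) = (\<Prod>p<n. w p (h p, h (Suc p))) * ?Q n f (h n)" .
    qed
    also have "\<dots> = (\<integral>\<^sup>+x. backward ?Q (Suc n) f x \<partial>\<mu>)"
      using Suc.IH[OF Qf] by simp
    finally show ?case .
  qed
  moreover have "(\<integral>\<^sup>+z. (\<Prod>p<n. w p (z p, z (Suc p))) * f (z n) \<partial>markov_law S \<mu> K)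
    = (\<integral>\<^sup>+h. (\<Prod>p<n. w p (h p, h (Suc p))) * f (h n) \<partial>C 0 (Suc n) (\<lambda>_. undefined))"
    unfolding markov_law_def nn_integral_Ionescu_Tulcea_lim[OF IT Fm[OF f], symmetric]
    by (intro nn_integral_cong arg_cong2[where f="(*)"] prod.cong) auto
  ultimately show ?thesis by simp
qed

section \<open>Random weighted kernels\<close>

lemma ennreal_mult_cancel_left_le:
  fixes x y :: ennreal
  assumes "0 < a" and "ennreal a * x \<le> ennreal b * y"
  shows "x \<le> ennreal (b / a) * y"
proof -
  have "ennreal (1 / a) * (ennreal a * x) \<le> ennreal (1 / a) * (ennreal b * y)"
    by (rule mult_left_mono[OF assms(2)]) simp
  moreover have "ennreal (1 / a) * ennreal a = 1" using assms(1) by (simp add: ennreal_mult'[symmetric])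
  moreover have "ennreal (1 / a) * ennreal b = ennreal (b / a)"
    using ennreal_mult''[of "1 / a" b] assms(1) by (simp add: ac_simps)
  ultimately show ?thesis by (simp add: mult.assoc[symmetric])
qed

definition weighted_op ::
    "('w \<times> 's \<Rightarrow> 's measure) \<Rightarrow> ('w \<times> 's \<times> 's \<Rightarrow> ennreal) \<Rightarrow> 'w \<Rightarrow> ('s \<Rightarrow> ennreal) \<Rightarrow> 's \<Rightarrow> ennreal" where
  "weighted_op K w \<omega> f x = (\<integral>\<^sup>+y. w (\<omega>, x, y) * f y \<partial>K (\<omega>, x))"

text \<open>The unnormalised Feynman-Kac semigroup along the orbit of \<open>\<omega>\<close>; its
  cocycle property is \<open>weighted_ops_add\<close>.\<close>

definition weighted_ops ::
    "('w \<Rightarrow> 'w) \<Rightarrow> ('w \<times> 's \<Rightarrow> 's measure) \<Rightarrow> ('w \<times> 's \<times> 's \<Rightarrow> ennreal) \<Rightarrow> nat \<Rightarrow> 'w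
      \<Rightarrow> ('s \<Rightarrow> ennreal) \<Rightarrow> 's \<Rightarrow> ennreal" where
  "weighted_ops T K w n \<omega> = backward (\<lambda>p. weighted_op K w ((T ^^ p) \<omega>)) n"

lemma weighted_ops_0[simp]: "weighted_ops T K w 0 \<omega> f = f"
  by (simp add: weighted_ops_def)

lemma weighted_ops_Suc:
  "weighted_ops T K w (Suc n) \<omega> f = weighted_ops T K w n \<omega> (weighted_op K w ((T ^^ n) \<omega>) f)"
  by (simp add: weighted_ops_def)

lemma weighted_ops_add:
  "weighted_ops T K w (m + n) \<omega> f = weighted_ops T K w m \<omega> (weighted_ops T K w n ((T ^^ m) \<omega>) f)"
proof (induction n arbitrary: f)
  case (Suc n)
  have "(T ^^ n) ((T ^^ m) \<omega>) = (T ^^ (m + n)) \<omega>" by (simp add: funpow_add[of n m, simplified add.commute])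
  with Suc show ?case by (simp add: weighted_ops_Suc)
qed simp

lemma weighted_ops_Suc':
  "weighted_ops T K w (Suc n) \<omega> f = weighted_op K w \<omega> (weighted_ops T K w n (T \<omega>) f)"
  using weighted_ops_add[of T K w 1 n \<omega> f] by (simp add: weighted_ops_Suc)

text \<open>Common setting for denominator and numerator of the relative variance. The weight may be
  unbounded, so the mixing condition concerns the weighted operator; \<open>\<rho>\<close>,
  \<open>a\<close> and \<open>b\<close> depend neither on the environment nor on the state.\<close>

locale random_weighted_kernel =
  fixes W :: "'w measure" and S :: "'s measure" and T :: "'w \<Rightarrow> 'w"
    and K :: "'w \<times> 's \<Rightarrow> 's measure" and w :: "'w \<times> 's \<times> 's \<Rightarrow> ennreal"
    and \<rho> :: "'s measure" and a b :: real
  assumes K: "K \<in> W \<Otimes>\<^sub>M S \<rightarrow>\<^sub>M prob_algebra S"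
    and w: "w \<in> borel_measurable (W \<Otimes>\<^sub>M (S \<Otimes>\<^sub>M S))"
    and T: "T \<in> W \<rightarrow>\<^sub>M W"
    and \<rho>_finite: "finite_measure \<rho>" and sets_\<rho>: "sets \<rho> = sets S"
    and \<rho>_pos: "0 < emeasure \<rho> (space \<rho>)"
    and a: "0 < a" and b: "0 < b"
    and lower: "\<And>\<omega> x f. \<omega> \<in> space W \<Longrightarrow> x \<in> space S \<Longrightarrow> f \<in> borel_measurable S \<Longrightarrow>
      ennreal a * (\<integral>\<^sup>+y. f y \<partial>\<rho>) \<le> weighted_op K w \<omega> f x"
    and upper: "\<And>\<omega> x f. \<omega> \<in> space W \<Longrightarrow> x \<in> space S \<Longrightarrow> f \<in> borel_measurable S \<Longrightarrow>
      weighted_op K w \<omega> f x \<le> ennreal b * (\<integral>\<^sup>+y. f y \<partial>\<rho>)"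
begin

abbreviation "Q \<equiv> weighted_op K w"
abbreviation "Qs \<equiv> weighted_ops T K w"
abbreviation "h n \<omega> \<equiv> Qs n \<omega> (\<lambda>_. 1)"

lemma sets_K: "\<omega> \<in> space W \<Longrightarrow> x \<in> space S \<Longrightarrow> sets (K (\<omega>, x)) = sets S"
  using measurable_space[OF K, of "(\<omega>, x)"] by (simp add: space_pair_measure space_prob_algebra)

lemma space_K: "\<omega> \<in> space W \<Longrightarrow> x \<in> space S \<Longrightarrow> space (K (\<omega>, x)) = space S"
  using sets_K sets_eq_imp_space_eq by blast

lemma space_\<rho>: "space \<rho> = space S"
  using sets_\<rho> sets_eq_imp_space_eq by blast

lemma T_space: "\<omega> \<in> space W \<Longrightarrow> (T ^^ n) \<omega> \<in> space W"
  using measurable_space[OF measurable_funpow_self[OF T]] .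

section \<open>Monotonicity, homogeneity and measurability of the weighted operators\<close>

lemma Q_mono:
  assumes "\<omega> \<in> space W" "x \<in> space S" "\<And>y. y \<in> space S \<Longrightarrow> f y \<le> g y"
  shows "Q \<omega> f x \<le> Q \<omega> g x"
  unfolding weighted_op_def
  by (intro nn_integral_mono mult_left_mono) (auto simp: assms space_K)

lemma Qs_mono:
  assumes "\<omega> \<in> space W" "x \<in> space S" "\<And>y. y \<in> space S \<Longrightarrow> f y \<le> g y"
  shows "Qs n \<omega> f x \<le> Qs n \<omega> g x"
  using assms(2,3)
proof (induction n arbitrary: f g x)
  case (Suc n)
  show ?case unfolding weighted_ops_Suc
    by (rule Suc.IH[OF Suc.prems(1)]) (rule Q_mono[OF T_space[OF assms(1)] _ Suc.prems(2)])
qed simp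

lemma Q_cmult:
  assumes [measurable]: "f \<in> borel_measurable S" and "\<omega> \<in> space W" "x \<in> space S"
  shows "Q \<omega> (\<lambda>y. c * f y) x = c * Q \<omega> f x"
proof -
  note w[measurable]
  note sets_K[OF assms(2,3), measurable_cong]
  have "Q \<omega> (\<lambda>y. c * f y) x = (\<integral>\<^sup>+y. c * (w (\<omega>, x, y) * f y) \<partial>K (\<omega>, x))"
    unfolding weighted_op_def by (simp add: ac_simps)
  also have "\<dots> = c * Q \<omega> f x"
    unfolding weighted_op_def using assms(2,3) by (intro nn_integral_cmult) measurable
  finally show ?thesis .
qed

lemma measurable_Q_pair:
  assumes f: "(\<lambda>(\<omega>, x). f \<omega> x) \<in> borel_measurable (W \<Otimes>\<^sub>M S)"
  shows "(\<lambda>(\<omega>, x). Q \<omega> (f \<omega>) x) \<in> borel_measurable (W \<Otimes>\<^sub>M S)"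
proof -
  note w[measurable] f[measurable]
  have "(\<lambda>z. \<integral>\<^sup>+y. w (fst z, snd z, y) * f (fst z) y \<partial>K z) \<in> borel_measurable (W \<Otimes>\<^sub>M S)"
    by (rule nn_integral_measurable_subprob_algebra2[OF _ measurable_prob_algebraD[OF K]]) measurable
  then show ?thesis by (simp add: weighted_op_def case_prod_unfold)
qed

lemma measurable_Q:
  assumes f: "f \<in> borel_measurable S" and \<omega>: "\<omega> \<in> space W"
  shows "Q \<omega> f \<in> borel_measurable S"
proof -
  have "(\<lambda>(\<omega>, x). Q \<omega> f x) \<in> borel_measurable (W \<Otimes>\<^sub>M S)"
    by (rule measurable_Q_pair) (use f in measurable)
  from measurable_compose[OF measurable_Pair1'[OF \<omega>] this] show ?thesis by simp
qed

lemma measurable_Qs: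
  assumes "f \<in> borel_measurable S" and "\<omega> \<in> space W"
  shows "Qs n \<omega> f \<in> borel_measurable S"
  using assms by (induction n arbitrary: f) (auto simp: weighted_ops_Suc intro!: measurable_Q T_space)

lemma measurable_h_pair: "(\<lambda>(\<omega>, x). h n \<omega> x) \<in> borel_measurable (W \<Otimes>\<^sub>M S)"
proof (induction n)
  case (Suc n)
  note T[measurable]
  from measurable_compose[OF _ Suc, of "\<lambda>(\<omega>, x). (T \<omega>, x)" "W \<Otimes>\<^sub>M S"]
  have "(\<lambda>(\<omega>, x). h n (T \<omega>) x) \<in> borel_measurable (W \<Otimes>\<^sub>M S)"
    by (simp add: case_prod_unfold)
  from measurable_Q_pair[OF this] show ?case by (simp add: weighted_ops_Suc')
qed simp

lemma Qs_cmult: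
  assumes "f \<in> borel_measurable S" and \<omega>: "\<omega> \<in> space W" and "x \<in> space S"
  shows "Qs n \<omega> (\<lambda>y. c * f y) x = c * Qs n \<omega> f x"
  using assms(1,3)
proof (induction n arbitrary: f x)
  case (Suc n)
  have "Qs n \<omega> (Q ((T ^^ n) \<omega>) (\<lambda>y. c * f y)) x = Qs n \<omega> (\<lambda>y. c * Q ((T ^^ n) \<omega>) f y) x"
    by (intro antisym Qs_mono \<omega> Suc.prems) (simp_all add: Q_cmult Suc.prems T_space \<omega>)
  with Suc show ?case by (simp add: weighted_ops_Suc measurable_Q T_space \<omega>)
qed simp

section \<open>Dependence on the starting point, mass bounds and growth rate\<close>

lemma obtain_point: obtains x where "x \<in> space S"
  using \<rho>_pos space_\<rho> by fastforce

lemma \<rho>_fin: "emeasure \<rho> (space \<rho>) < \<infinity>"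
  using finite_measure.emeasure_finite[OF \<rho>_finite] by (simp add: top.not_eq_extremum)

text \<open>Both bounds are tested on the constant 1, and the finite positive mass of
  \<open>\<rho>\<close> cancels. The resulting \<open>1 \<le> b / a\<close> settles horizon 0 in
  \<open>h_comparable\<close>.\<close>

lemma W_nonempty_a_le_b: "\<omega> \<in> space W \<Longrightarrow> a \<le> b"
proof -
  assume \<omega>: "\<omega> \<in> space W"
  obtain x where x: "x \<in> space S" by (rule obtain_point)
  obtain m where m: "emeasure \<rho> (space \<rho>) = ennreal m" "0 < m"
    using \<rho>_fin \<rho>_pos by (cases "emeasure \<rho> (space \<rho>)") auto
  have "ennreal a * ennreal m \<le> ennreal b * ennreal m"
    using order_trans[OF lower[OF \<omega> x, of "\<lambda>_. 1"] upper[OF \<omega> x, of "\<lambda>_. 1"]] by (simp add: m)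
  then show ?thesis using m a b by (simp add: ennreal_mult'[symmetric])
qed

text \<open>One step forgets the starting point: from \<open>x\<close> and from \<open>x'\<close>
  alike, the first operator is sandwiched between multiples of the same
  \<open>\<rho>\<close>-integral of the remaining growth \<open>h m (T \<omega>)\<close>.\<close>

lemma h_comparable:
  assumes \<omega>: "\<omega> \<in> space W" and x: "x \<in> space S" and x': "x' \<in> space S"
  shows "h n \<omega> x' \<le> ennreal (b / a) * h n \<omega> x"
proof (cases n)
  case 0
  then show ?thesis using W_nonempty_a_le_b[OF \<omega>] a by simp
next
  case (Suc m)
  let ?f = "h m (T \<omega>)"
  have f: "?f \<in> borel_measurable S" using measurable_Qs[of _ "T \<omega>"] T_space[OF \<omega>, of 1] by simp
  have "ennreal a * h n \<omega> x' \<le> ennreal a * (ennreal b * (\<integral>\<^sup>+y. ?f y \<partial>\<rho>))"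
    unfolding Suc weighted_ops_Suc' by (intro mult_left_mono upper \<omega> x' f) simp
  also have "\<dots> = ennreal b * (ennreal a * (\<integral>\<^sup>+y. ?f y \<partial>\<rho>))" by (simp add: ac_simps)
  also have "\<dots> \<le> ennreal b * h n \<omega> x"
    unfolding Suc weighted_ops_Suc' by (intro mult_left_mono lower \<omega> x f) simp
  finally show ?thesis by (rule ennreal_mult_cancel_left_le[OF a])
qed

text \<open>With \<open>m\<close> the mass of \<open>\<rho>\<close>, one step on the constant 1 lies
  between \<open>a * m\<close> and \<open>b * m\<close>, and iteration gives geometric bounds. They
  keep the logarithms of the growth finite and bounded for each fixed \<open>n\<close>, as the
  ergodic theorem requires.\<close>

lemma h_bounds:
  obtains c d :: real where "0 < c" "0 < d"
    "\<And>n \<omega> x. \<omega> \<in> space W \<Longrightarrow> x \<in> space S \<Longrightarrow> ennreal (c ^ n) \<le> h n \<omega> x \<and> h n \<omega> x \<le> ennreal (d ^ n)"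
proof -
  obtain m where m: "emeasure \<rho> (space \<rho>) = ennreal m" "0 < m"
    using \<rho>_fin \<rho>_pos by (cases "emeasure \<rho> (space \<rho>)") auto
  have Q1: "ennreal (a * m) \<le> Q \<omega> (\<lambda>_. 1) x \<and> Q \<omega> (\<lambda>_. 1) x \<le> ennreal (b * m)"
    if "\<omega> \<in> space W" "x \<in> space S" for \<omega> x
    using lower[OF that, of "\<lambda>_. 1"] upper[OF that, of "\<lambda>_. 1"] a b m by (simp add: ennreal_mult')
  have "ennreal ((a * m) ^ n) \<le> h n \<omega> x \<and> h n \<omega> x \<le> ennreal ((b * m) ^ n)"
    if "\<omega> \<in> space W" "x \<in> space S" for n \<omega> x
    using that
  proof (induction n arbitrary: x)
    case (Suc n)
    have \<omega>: "(T ^^ n) \<omega> \<in> space W" by (rule T_space[OF Suc.prems(1)])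
    have e: "ennreal c * h n \<omega> x = Qs n \<omega> (\<lambda>_. ennreal c) x" for c
      using Qs_cmult[OF _ Suc.prems, of "\<lambda>_. 1" n "ennreal c"] by simp
    have "ennreal ((a * m) ^ Suc n) \<le> ennreal (a * m) * h n \<omega> x"
      using Suc a m by (auto simp: ennreal_mult' intro!: mult_left_mono)
    also have "\<dots> \<le> h (Suc n) \<omega> x"
      unfolding e weighted_ops_Suc by (intro Qs_mono Suc.prems) (use Q1 \<omega> in auto)
    finally have "ennreal ((a * m) ^ Suc n) \<le> h (Suc n) \<omega> x" .
    moreover have "h (Suc n) \<omega> x \<le> ennreal (b * m) * h n \<omega> x"
      unfolding e weighted_ops_Suc by (intro Qs_mono Suc.prems) (use Q1 \<omega> in auto)
    moreover have "ennreal (b * m) * h n \<omega> x \<le> ennreal ((b * m) ^ Suc n)"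
      using Suc b m by (auto simp: ennreal_mult' intro!: mult_left_mono)
    ultimately show ?case by (meson order_trans)
  qed simp
  then show ?thesis by (intro that[of "a * m" "b * m"]) (use a b m in auto)
qed

text \<open>By \<open>h_comparable\<close>, \<open>\<omega> \<mapsto> ln (h n \<omega> x0)\<close> is an additive cocycle up to the error \<open>ln (b / a)\<close>.\<close>

theorem growth_rate:
  assumes "prob_space P" and sets_P: "sets P = sets W"
    and mp: "measure_preserving P T" and erg: "ergodic P T"
  shows "\<exists>L. AE \<omega> in P. \<forall>\<mu>. prob_space \<mu> \<longrightarrow> sets \<mu> = sets S \<longrightarrow>
    (\<forall>n. 0 < (\<integral>\<^sup>+x. h n \<omega> x \<partial>\<mu>) \<and> (\<integral>\<^sup>+x. h n \<omega> x \<partial>\<mu>) < \<infinity>) \<and>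
    (\<lambda>n. ln (enn2real (\<integral>\<^sup>+x. h n \<omega> x \<partial>\<mu>)) / real n) \<longlonglongrightarrow> L"
proof -
  have space_P: "space P = space W" using sets_P sets_eq_imp_space_eq by blast
  obtain x0 where x0: "x0 \<in> space S" by (rule obtain_point)
  obtain c d where c: "0 < c" and d: "0 < d"
    and cd: "\<And>n \<omega> x. \<omega> \<in> space W \<Longrightarrow> x \<in> space S \<Longrightarrow> ennreal (c ^ n) \<le> h n \<omega> x \<and> h n \<omega> x \<le> ennreal (d ^ n)"
    using h_bounds by blast
  define C where "C = ln (b / a)"
  have ln_close: "\<bar>ln (enn2real p) - ln (enn2real q)\<bar> \<le> C"
    if fin: "0 < p" "p < \<infinity>" "0 < q" "q < \<infinity>" and le: "p \<le> ennreal (b / a) * q" "q \<le> ennreal (b / a) * p" for p q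
  proof -
    obtain p' q' where pq: "p = ennreal p'" "q = ennreal q'" "0 < p'" "0 < q'"
      using fin by (cases p; cases q) auto
    have "p' \<le> b / a * q'" "q' \<le> b / a * p'"
      using le pq a b by (simp_all add: ennreal_mult'[symmetric])
    then have "ln p' \<le> ln (b / a * q')" "ln q' \<le> ln (b / a * p')" using pq by simp_all
    moreover have "ln (b / a * q') = C + ln q'" "ln (b / a * p') = C + ln p'"
      using ln_mult_pos[of "b / a" q'] ln_mult_pos[of "b / a" p'] pq(3,4) a b by (simp_all add: C_def)
    ultimately have "\<bar>ln p' - ln q'\<bar> \<le> C" by linarith
    then show ?thesis using pq by simp
  qed
  have fin: "0 < h n \<omega> x \<and> h n \<omega> x < \<infinity>" if "\<omega> \<in> space W" "x \<in> space S" for n \<omega> x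
  proof
    have "0 < ennreal (c ^ n)" using c by simp
    then show "0 < h n \<omega> x" using cd[OF that, of n] less_le_trans by blast
    show "h n \<omega> x < \<infinity>" using cd[OF that, of n] le_less_trans[OF _ ennreal_less_top] by auto
  qed
  define u where "u n \<omega> = ln (enn2real (h n \<omega> x0))" for n \<omega>
  have bd: "\<bar>u n \<omega>\<bar> \<le> real n * (\<bar>ln c\<bar> + \<bar>ln d\<bar>)" if \<omega>: "\<omega> \<in> space P" for n \<omega>
  proof -
    obtain r where r: "h n \<omega> x0 = ennreal r" "0 < r"
      using fin[of \<omega> x0 n] \<omega> x0 space_P by (cases "h n \<omega> x0") auto
    have "c ^ n \<le> r" "r \<le> d ^ n" using cd[of \<omega> x0 n] \<omega> x0 space_P r c d by auto
    then have "real n * ln c \<le> ln r" "ln r \<le> real n * ln d"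
      using r c d by (simp_all flip: ln_realpow add: zero_less_power)
    moreover have "real n * ln d \<le> real n * \<bar>ln d\<bar>" "real n * (- ln c) \<le> real n * \<bar>ln c\<bar>"
      by (rule mult_left_mono; simp)+
    moreover have "0 \<le> real n * \<bar>ln d\<bar>" "0 \<le> real n * \<bar>ln c\<bar>" by auto
    ultimately have "\<bar>ln r\<bar> \<le> real n * \<bar>ln c\<bar> + real n * \<bar>ln d\<bar>" by linarith
    then show ?thesis using r by (simp add: u_def distrib_left)
  qed
  have aa: "\<bar>u (m + n) \<omega> - u m \<omega> - u n ((T ^^ m) \<omega>)\<bar> \<le> C" if "\<omega> \<in> space P" for m n \<omega>
  proof -
    have \<omega>: "\<omega> \<in> space W" using that space_P by simp
    then have \<omega>': "(T ^^ m) \<omega> \<in> space W" by (rule T_space)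
    let ?p = "h (m + n) \<omega> x0" and ?q = "h n ((T ^^ m) \<omega>) x0 * h m \<omega> x0"
    have Q1: "Qs m \<omega> (\<lambda>_. k) x0 = k * h m \<omega> x0" for k
      using Qs_cmult[OF _ \<omega> x0, of "\<lambda>_. 1" m k] by simp
    \<comment> \<open>The growth over the last \<open>n\<close> steps is replaced by its value at
      \<open>x0\<close> at the cost of \<open>b / a\<close>; being constant, this value leaves the
      operator and \<open>h m \<omega> x0\<close> remains.\<close>
    have "?p \<le> Qs m \<omega> (\<lambda>_. ennreal (b / a) * h n ((T ^^ m) \<omega>) x0) x0"
      unfolding weighted_ops_add by (intro Qs_mono \<omega> x0 h_comparable \<omega>')
    then have 1: "?p \<le> ennreal (b / a) * ?q"
      by (simp add: Q1[of "ennreal (b / a) * h n ((T ^^ m) \<omega>) x0"] mult.assoc)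
    have "Qs m \<omega> (\<lambda>_. h n ((T ^^ m) \<omega>) x0) x0 \<le> Qs m \<omega> (\<lambda>y. ennreal (b / a) * h n ((T ^^ m) \<omega>) y) x0"
      by (intro Qs_mono \<omega> x0 h_comparable \<omega>')
    then have 2: "?q \<le> ennreal (b / a) * ?p"
      by (simp add: Q1[of "h n ((T ^^ m) \<omega>) x0"] weighted_ops_add Qs_cmult \<omega> x0 measurable_Qs \<omega>')
    have f1: "0 < h n ((T ^^ m) \<omega>) x0" "h n ((T ^^ m) \<omega>) x0 < \<infinity>" and f2: "0 < h m \<omega> x0" "h m \<omega> x0 < \<infinity>"
      using fin[OF \<omega>' x0] fin[OF \<omega> x0] by auto
    have q: "0 < ?q" "?q < \<infinity>" using f1 f2 by (auto simp: ennreal_zero_less_mult_iff ennreal_mult_less_top)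
    have "\<bar>ln (enn2real ?p) - ln (enn2real ?q)\<bar> \<le> C"
      using ln_close[OF _ _ q 1 2] fin[OF \<omega> x0] by blast
    moreover have "ln (enn2real ?q) = u n ((T ^^ m) \<omega>) + u m \<omega>"
      unfolding u_def enn2real_mult by (rule ln_mult_pos) (use f1 f2 in \<open>auto simp: enn2real_positive_iff\<close>)
    ultimately show ?thesis by (simp add: u_def)
  qed
  have um: "u n \<in> borel_measurable P" for n
  proof -
    have "(\<lambda>\<omega>. h n \<omega> x0) \<in> borel_measurable W"
      using measurable_compose[OF measurable_Pair2'[OF x0] measurable_h_pair[of n]] by simp
    then have "(\<lambda>\<omega>. h n \<omega> x0) \<in> borel_measurable P" using measurable_cong_sets[OF sets_P refl] by blast
    then show ?thesis unfolding u_def[abs_def] by measurable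
  qed
  obtain L where L: "AE \<omega> in P. (\<lambda>n. u n \<omega> / real n) \<longlonglongrightarrow> L"
    using almost_additive_ergodic[OF assms(1) mp erg um aa bd] by blast
  show ?thesis
  proof (intro exI[of _ L])
    show "AE \<omega> in P. \<forall>\<mu>. prob_space \<mu> \<longrightarrow> sets \<mu> = sets S \<longrightarrow>
      (\<forall>n. 0 < (\<integral>\<^sup>+x. h n \<omega> x \<partial>\<mu>) \<and> (\<integral>\<^sup>+x. h n \<omega> x \<partial>\<mu>) < \<infinity>) \<and>
      (\<lambda>n. ln (enn2real (\<integral>\<^sup>+x. h n \<omega> x \<partial>\<mu>)) / real n) \<longlonglongrightarrow> L"
      using L AE_space
    proof eventually_elim
      case (elim \<omega>)
      then have \<omega>: "\<omega> \<in> space W" by (simp add: space_P)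
      show ?case
      proof (intro allI impI)
        fix \<mu> :: "'s measure" assume \<mu>: "prob_space \<mu>" "sets \<mu> = sets S"
        interpret \<mu>: prob_space \<mu> by fact
        have sp: "space \<mu> = space S" using \<mu>(2) sets_eq_imp_space_eq by blast
        let ?I = "\<lambda>n. \<integral>\<^sup>+x. h n \<omega> x \<partial>\<mu>"
        \<comment> \<open>Comparability survives averaging over the starting point, so the logarithm
          of \<open>?I n\<close> stays within \<open>C\<close> of \<open>u n \<omega>\<close>. The
          exceptional set is the one of the reference point \<open>x0\<close>, which is why the
          quantifier over \<open>\<mu>\<close> can stand inside the almost sure statement.\<close>
        have I_up: "?I n \<le> ennreal (b / a) * h n \<omega> x0" for n
        proof -
          have "?I n \<le> (\<integral>\<^sup>+x. ennreal (b / a) * h n \<omega> x0 \<partial>\<mu>)"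
            by (intro nn_integral_mono h_comparable \<omega> x0) (simp add: sp)
          then show ?thesis by (simp add: \<mu>.emeasure_space_1)
        qed
        have I_lo: "h n \<omega> x0 \<le> ennreal (b / a) * ?I n" for n
        proof -
          have "h n \<omega> x0 = (\<integral>\<^sup>+x. h n \<omega> x0 \<partial>\<mu>)" by (simp add: \<mu>.emeasure_space_1)
          also have "\<dots> \<le> (\<integral>\<^sup>+x. ennreal (b / a) * h n \<omega> x \<partial>\<mu>)"
            by (intro nn_integral_mono h_comparable \<omega> x0) (simp add: sp)
          also have "\<dots> = ennreal (b / a) * ?I n"
            by (intro nn_integral_cmult) (use measurable_Qs[OF _ \<omega>] \<mu>(2) in \<open>simp cong: measurable_cong_sets\<close>)
          finally show ?thesis .
        qed
        have I: "0 < ?I n" "?I n < \<infinity>" for n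
        proof -
          show "0 < ?I n" using I_lo[of n] fin[OF \<omega> x0, of n] by (metis mult_zero_right not_less zero_less_iff_neq_zero)
          show "?I n < \<infinity>" using I_up[of n] fin[OF \<omega> x0, of n]
            by (metis ennreal_less_top ennreal_mult_less_top infinity_ennreal_def le_less_trans)
        qed
        have "(\<lambda>n. ln (enn2real (?I n)) / real n - u n \<omega> / real n) \<longlonglongrightarrow> 0"
        proof (rule Lim_null_comparison[OF _ lim_const_over_n[of C]])
          have "\<bar>ln (enn2real (?I n)) - u n \<omega>\<bar> \<le> C" for n
            unfolding u_def using ln_close[OF I _ _ I_up I_lo] fin[OF \<omega> x0] by blast
          then show "\<forall>\<^sub>F n in sequentially. norm (ln (enn2real (?I n)) / real n - u n \<omega> / real n) \<le> C / real n"
            by (intro always_eventually allI)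
              (simp add: abs_divide divide_right_mono flip: diff_divide_distrib)
        qed
        from tendsto_add[OF this elim(1)]
        have "(\<lambda>n. ln (enn2real (?I n)) / real n) \<longlonglongrightarrow> L" by simp
        with I show "(\<forall>n. 0 < ?I n \<and> ?I n < \<infinity>) \<and> (\<lambda>n. ln (enn2real (?I n)) / real n) \<longlonglongrightarrow> L" by blast
      qed
    qed
  qed
qed

lemma nn_integral_env:
  fixes \<omega> :: 'w
  assumes \<mu>: "prob_space \<mu>" "sets \<mu> = sets S" and \<omega>: "\<omega> \<in> space W"
  shows "(\<integral>\<^sup>+z. (\<Prod>p<n. w ((T ^^ p) \<omega>, z p, z (Suc p))) \<partial>markov_law S \<mu> (\<lambda>n s. K ((T ^^ n) \<omega>, s)))
    = (\<integral>\<^sup>+x. h n \<omega> x \<partial>\<mu>)"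
proof -
  have "(\<integral>\<^sup>+z. (\<Prod>p<n. (\<lambda>p (x, y). w ((T ^^ p) \<omega>, x, y)) p (z p, z (Suc p))) * 1
      \<partial>markov_law S \<mu> (\<lambda>n s. K ((T ^^ n) \<omega>, s)))
    = (\<integral>\<^sup>+x. backward (\<lambda>p g x. \<integral>\<^sup>+y. (\<lambda>p (x, y). w ((T ^^ p) \<omega>, x, y)) p (x, y) * g y \<partial>K ((T ^^ p) \<omega>, x)) n (\<lambda>_. 1) x \<partial>\<mu>)"
  proof (rule nn_integral_markov_law[OF \<mu>])
    fix p
    have o: "(T ^^ p) \<omega> \<in> space W" by (rule T_space[OF \<omega>])
    show "(\<lambda>s. K ((T ^^ p) \<omega>, s)) \<in> S \<rightarrow>\<^sub>M prob_algebra S"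
      by (rule measurable_compose[OF measurable_Pair1'[OF o] K])
    show "(\<lambda>(x, y). w ((T ^^ p) \<omega>, x, y)) \<in> borel_measurable (S \<Otimes>\<^sub>M S)"
      using measurable_compose[OF measurable_Pair1'[OF o] w] by (simp add: case_prod_unfold)
  qed simp
  then show ?thesis by (simp add: weighted_ops_def weighted_op_def[abs_def])
qed

end

section \<open>Comparison of measures\<close>

lemma nn_integral_le_scaled:
  assumes sets: "sets \<mu> = sets \<nu>" and le: "\<And>A. A \<in> sets \<nu> \<Longrightarrow> emeasure \<mu> A \<le> c * emeasure \<nu> A"
    and f: "f \<in> borel_measurable \<nu>"
  shows "(\<integral>\<^sup>+x. f x \<partial>\<mu>) \<le> c * (\<integral>\<^sup>+x. f x \<partial>\<nu>)"
proof -
  have "\<mu> \<le> scale_measure c \<nu>"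
    using le sets by (subst le_measure) (auto intro!: le_funI simp: emeasure_notin_sets)
  then have "(\<integral>\<^sup>+x. f x \<partial>\<mu>) \<le> (\<integral>\<^sup>+x. f x \<partial>scale_measure c \<nu>)"
    by (intro nn_integral_mono_measure) (simp_all add: sets)
  also have "\<dots> = c * (\<integral>\<^sup>+x. f x \<partial>\<nu>)" by (rule nn_integral_scale_measure[OF f])
  finally show ?thesis .
qed

text \<open>The inequality is tested on the set where it fails. Finiteness of the integral of
  \<open>g\<close> permits subtraction, and the excess of \<open>f\<close> over \<open>g\<close> on
  that set integrates to 0.\<close>

lemma AE_le_of_set_integral_le:
  fixes f g :: "'a \<Rightarrow> ennreal"
  assumes [measurable]: "f \<in> borel_measurable M" "g \<in> borel_measurable M"
    and fin: "(\<integral>\<^sup>+x. g x \<partial>M) < \<infinity>"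
    and le: "\<And>A. A \<in> sets M \<Longrightarrow> (\<integral>\<^sup>+x. f x * indicator A x \<partial>M) \<le> (\<integral>\<^sup>+x. g x * indicator A x \<partial>M)"
  shows "AE x in M. f x \<le> g x"
proof -
  let ?A = "{x \<in> space M. g x < f x}"
  let ?f = "\<lambda>x. f x * indicator ?A x" and ?g = "\<lambda>x. g x * indicator ?A x"
  have "(\<integral>\<^sup>+x. ?g x \<partial>M) \<le> (\<integral>\<^sup>+x. g x \<partial>M)"
    by (intro nn_integral_mono) (auto simp: indicator_def)
  then have gfin: "(\<integral>\<^sup>+x. ?g x \<partial>M) < \<infinity>" using fin by (rule le_less_trans)
  have "(\<integral>\<^sup>+x. ?f x - ?g x \<partial>M) = (\<integral>\<^sup>+x. ?f x \<partial>M) - (\<integral>\<^sup>+x. ?g x \<partial>M)"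
    using gfin by (intro nn_integral_diff) (auto simp: indicator_def)
  also have "\<dots> = 0" using le[of ?A] gfin by (auto simp: diff_eq_0_iff_ennreal intro: le_less_trans)
  finally have "AE x in M. ?f x - ?g x = 0" by (subst (asm) nn_integral_0_iff_AE) measurable
  then show ?thesis
    using AE_space
  proof eventually_elim
    case (elim x)
    then show ?case by (cases "g x < f x") (auto simp: diff_eq_0_iff_ennreal not_less)
  qed
qed

lemma AE_density_le:
  fixes f g :: "'a \<Rightarrow> ennreal"
  assumes [measurable]: "f \<in> borel_measurable M" "g \<in> borel_measurable M"
    and fin: "c < \<infinity>" "emeasure (density M g) (space M) < \<infinity>"
    and le: "\<And>A. A \<in> sets M \<Longrightarrow> emeasure (density M f) A \<le> c * emeasure (density M g) A"
  shows "AE x in M. f x \<le> c * g x"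
proof (rule AE_le_of_set_integral_le)
  have "(\<integral>\<^sup>+x. g x * indicator (space M) x \<partial>M) = (\<integral>\<^sup>+x. g x \<partial>M)"
    by (intro nn_integral_cong) simp
  then show "(\<integral>\<^sup>+x. c * g x \<partial>M) < \<infinity>"
    using fin by (simp add: nn_integral_cmult ennreal_mult_less_top emeasure_density)
  show "(\<integral>\<^sup>+x. f x * indicator A x \<partial>M) \<le> (\<integral>\<^sup>+x. c * g x * indicator A x \<partial>M)" if A: "A \<in> sets M" for A
    using le[OF A] A by (simp add: emeasure_density nn_integral_cmult mult.assoc)
qed measurable

text \<open>With all measures written as densities \<open>m\<close>, \<open>r\<close> and \<open>m * \<phi>\<close> with respect to \<open>\<nu>'\<close>, the
  squared weight satisfies \<open>m * \<phi>\<^sup>2 = (m * \<phi>)\<^sup>2 / m\<close>, where \<open>m\<close> is bounded above and below and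
  \<open>m * \<phi>\<close> is comparable to \<open>r\<close>.\<close>

lemma nn_integral_squared_density_bounds:
  fixes \<nu>' K L R :: "'a measure" and em ep cu cl :: real
  assumes ps: "prob_space \<nu>'" "prob_space K" "prob_space L" "prob_space R"
    and sets: "sets K = sets \<nu>'" "sets R = sets \<nu>'" "sets L = sets \<nu>'"
    and pos: "0 < em" "0 < ep" "0 < cu" "0 < cl"
    and K_lower: "\<And>A. A \<in> sets \<nu>' \<Longrightarrow> em * measure \<nu>' A \<le> measure K A"
    and K_upper: "\<And>A. A \<in> sets \<nu>' \<Longrightarrow> measure K A \<le> ep * measure \<nu>' A"
    and L_upper: "\<And>A. A \<in> sets \<nu>' \<Longrightarrow> emeasure L A \<le> ennreal cu * emeasure R A"
    and L_lower: "\<And>A. A \<in> sets \<nu>' \<Longrightarrow> emeasure R A \<le> ennreal cl * emeasure L A"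
    and R: "absolutely_continuous \<nu>' R"
    and \<phi>: "\<phi> \<in> borel_measurable \<nu>'" and \<phi>L: "density K \<phi> = L"
    and f: "f \<in> borel_measurable \<nu>'"
  defines "\<rho> \<equiv> density \<nu>' (\<lambda>x. (RN_deriv \<nu>' R x)\<^sup>2)"
  shows "(\<integral>\<^sup>+x. (\<phi> x)\<^sup>2 * f x \<partial>K) \<le> ennreal (cu\<^sup>2 / em) * (\<integral>\<^sup>+x. f x \<partial>\<rho>)"
    and "ennreal (1 / (cl\<^sup>2 * ep)) * (\<integral>\<^sup>+x. f x \<partial>\<rho>) \<le> (\<integral>\<^sup>+x. (\<phi> x)\<^sup>2 * f x \<partial>K)"
proof -
  interpret \<nu>': prob_space \<nu>' by fact
  interpret K: prob_space K by fact
  interpret L: prob_space L by fact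
  interpret R: prob_space R by fact
  note \<phi>[measurable] f[measurable]
  have K_up: "emeasure K A \<le> ennreal ep * emeasure \<nu>' A" if "A \<in> sets \<nu>'" for A
    using K_upper[OF that] pos by (simp add: K.emeasure_eq_measure \<nu>'.emeasure_eq_measure ennreal_mult'[symmetric])
  have K_lo: "ennreal em * emeasure \<nu>' A \<le> emeasure K A" if "A \<in> sets \<nu>'" for A
    using K_lower[OF that] pos by (simp add: K.emeasure_eq_measure \<nu>'.emeasure_eq_measure ennreal_mult'[symmetric])
  have ac: "absolutely_continuous \<nu>' K"
    unfolding absolutely_continuous_def
  proof
    fix A assume A: "A \<in> null_sets \<nu>'"
    then have "emeasure K A \<le> ennreal ep * 0" using K_up[of A] by (simp add: null_setsD1 null_setsD2)
    then show "A \<in> null_sets K" using A by (simp add: null_sets_def sets)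
  qed
  define m where "m = RN_deriv \<nu>' K"
  define r where "r = RN_deriv \<nu>' R"
  have [measurable]: "m \<in> borel_measurable \<nu>'" "r \<in> borel_measurable \<nu>'" by (simp_all add: m_def r_def)
  have Km: "density \<nu>' m = K" unfolding m_def by (rule \<nu>'.density_RN_deriv[OF ac sets(1)])
  have Rr: "density \<nu>' r = R" unfolding r_def by (rule \<nu>'.density_RN_deriv[OF R sets(2)])
  have Lm: "density \<nu>' (\<lambda>x. m x * \<phi> x) = L"
    unfolding \<phi>L[symmetric] Km[symmetric] by (rule density_density_eq[symmetric]) measurable
  have \<nu>1: "density \<nu>' (\<lambda>_. 1) = \<nu>'" by (rule density_1)
  have mass: "emeasure K (space \<nu>') = 1" "emeasure L (space \<nu>') = 1" "emeasure R (space \<nu>') = 1"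
    using K.emeasure_space_1 L.emeasure_space_1 R.emeasure_space_1 sets[THEN sets_eq_imp_space_eq] by simp_all
  have 1: "AE x in \<nu>'. m x \<le> ennreal ep * 1"
    by (rule AE_density_le) (auto simp: Km \<nu>1 K_up \<nu>'.emeasure_space_1)
  \<comment> \<open>The lower bound on \<open>K\<close> becomes a bound on \<open>m\<close> by
    viewing \<open>\<nu>'\<close> itself as the measure with density 1.\<close>
  have 2: "AE x in \<nu>'. 1 \<le> ennreal (1 / em) * m x"
  proof (rule AE_density_le)
    show "emeasure (density \<nu>' (\<lambda>_. 1)) A \<le> ennreal (1 / em) * emeasure (density \<nu>' m) A" if "A \<in> sets \<nu>'" for A
      unfolding \<nu>1 Km
      by (rule ennreal_mult_cancel_left_le[OF pos(1), of _ 1, simplified]) (use K_lo[OF that] in simp)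
  qed (auto simp: Km mass)
  have 3: "AE x in \<nu>'. m x * \<phi> x \<le> ennreal cu * r x"
    by (rule AE_density_le) (auto simp: Lm Rr mass L_upper)
  have 4: "AE x in \<nu>'. r x \<le> ennreal cl * (m x * \<phi> x)"
    by (rule AE_density_le) (auto simp: Lm Rr mass L_lower)
  have K_eq: "(\<integral>\<^sup>+x. (\<phi> x)\<^sup>2 * f x \<partial>K) = (\<integral>\<^sup>+x. m x * ((\<phi> x)\<^sup>2 * f x) \<partial>\<nu>')"
    unfolding Km[symmetric] by (rule nn_integral_density) measurable
  have \<rho>_eq: "(\<integral>\<^sup>+x. f x \<partial>\<rho>) = (\<integral>\<^sup>+x. (r x)\<^sup>2 * f x \<partial>\<nu>')"
    unfolding \<rho>_def r_def[symmetric] by (rule nn_integral_density) measurable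
  have "(\<integral>\<^sup>+x. m x * ((\<phi> x)\<^sup>2 * f x) \<partial>\<nu>') \<le> (\<integral>\<^sup>+x. ennreal (cu\<^sup>2 / em) * ((r x)\<^sup>2 * f x) \<partial>\<nu>')"
  proof (rule nn_integral_mono_AE)
    show "AE x in \<nu>'. m x * ((\<phi> x)\<^sup>2 * f x) \<le> ennreal (cu\<^sup>2 / em) * ((r x)\<^sup>2 * f x)"
      using 2 3
    proof eventually_elim
      case (elim x)
      \<comment> \<open>Inserting the factor \<open>1 \<le> m x / em\<close> completes the square of
        \<open>m x * \<phi> x\<close> without dividing by \<open>m x\<close>.\<close>
      have "m x * (\<phi> x)\<^sup>2 = 1 * (m x * (\<phi> x)\<^sup>2)" by simp
      also have "\<dots> \<le> ennreal (1 / em) * m x * (m x * (\<phi> x)\<^sup>2)" by (rule mult_right_mono[OF elim(1)]) simp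
      also have "\<dots> = ennreal (1 / em) * (m x * \<phi> x)\<^sup>2" by (simp add: power2_eq_square ac_simps)
      also have "\<dots> \<le> ennreal (1 / em) * (ennreal cu * r x)\<^sup>2"
        by (intro mult_left_mono power_mono elim(2)) simp_all
      also have "\<dots> = ennreal (cu\<^sup>2 / em) * (r x)\<^sup>2"
        using pos ennreal_mult'[of "1 / em" "cu\<^sup>2"]
        by (simp add: power_mult_distrib ennreal_power mult.assoc[symmetric])
      finally have "m x * (\<phi> x)\<^sup>2 * f x \<le> ennreal (cu\<^sup>2 / em) * (r x)\<^sup>2 * f x" by (rule mult_right_mono) simp
      then show ?case by (simp add: mult.assoc)
    qed
  qed
  then show "(\<integral>\<^sup>+x. (\<phi> x)\<^sup>2 * f x \<partial>K) \<le> ennreal (cu\<^sup>2 / em) * (\<integral>\<^sup>+x. f x \<partial>\<rho>)"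
    by (simp add: K_eq \<rho>_eq nn_integral_cmult)
  have "(\<integral>\<^sup>+x. (r x)\<^sup>2 * f x \<partial>\<nu>') \<le> (\<integral>\<^sup>+x. ennreal (cl\<^sup>2 * ep) * (m x * ((\<phi> x)\<^sup>2 * f x)) \<partial>\<nu>')"
  proof (rule nn_integral_mono_AE)
    show "AE x in \<nu>'. (r x)\<^sup>2 * f x \<le> ennreal (cl\<^sup>2 * ep) * (m x * ((\<phi> x)\<^sup>2 * f x))"
      using 1 4
    proof eventually_elim
      case (elim x)
      \<comment> \<open>Conversely, one of the two factors \<open>m x\<close> in the square is
        bounded by \<open>ep\<close>; the other is kept to return to an integral against
        \<open>K\<close>.\<close>
      have "(r x)\<^sup>2 \<le> (ennreal cl * (m x * \<phi> x))\<^sup>2" by (intro power_mono elim(2)) simp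
      also have "\<dots> = ennreal (cl\<^sup>2) * (m x * (m x * (\<phi> x)\<^sup>2))"
        using pos by (simp add: power_mult_distrib ennreal_power power2_eq_square[of "m x"] mult.assoc)
      also have "\<dots> \<le> ennreal (cl\<^sup>2) * (ennreal ep * 1 * (m x * (\<phi> x)\<^sup>2))"
        by (intro mult_left_mono mult_right_mono elim(1)) simp_all
      also have "\<dots> = ennreal (cl\<^sup>2 * ep) * (m x * (\<phi> x)\<^sup>2)"
        by (simp add: ennreal_mult' mult.assoc)
      finally have "(r x)\<^sup>2 * f x \<le> ennreal (cl\<^sup>2 * ep) * (m x * (\<phi> x)\<^sup>2) * f x" by (rule mult_right_mono) simp
      then show ?case by (simp add: mult.assoc)
    qed
  qed
  then have "(\<integral>\<^sup>+x. f x \<partial>\<rho>) \<le> ennreal (cl\<^sup>2 * ep) * (\<integral>\<^sup>+x. (\<phi> x)\<^sup>2 * f x \<partial>K)"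
    by (simp add: K_eq \<rho>_eq nn_integral_cmult)
  then have "ennreal (1 / (cl\<^sup>2 * ep)) * (\<integral>\<^sup>+x. f x \<partial>\<rho>)
      \<le> ennreal (1 / (cl\<^sup>2 * ep)) * (ennreal (cl\<^sup>2 * ep) * (\<integral>\<^sup>+x. (\<phi> x)\<^sup>2 * f x \<partial>K))"
    by (rule mult_left_mono) simp
  also have "\<dots> = (\<integral>\<^sup>+x. (\<phi> x)\<^sup>2 * f x \<partial>K)"
    using pos ennreal_mult'[of "1 / (cl\<^sup>2 * ep)" "cl\<^sup>2 * ep"] by (simp add: mult.assoc[symmetric])
  finally show "ennreal (1 / (cl\<^sup>2 * ep)) * (\<integral>\<^sup>+x. f x \<partial>\<rho>) \<le> (\<integral>\<^sup>+x. (\<phi> x)\<^sup>2 * f x \<partial>K)" .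
qed

text \<open>Fubini, one coordinate at a time, each contributing a factor \<open>c\<close>. The claim
  is made for functions because the inner integral over one coordinate is no longer an
  indicator.\<close>

lemma nn_integral_PiM_le_scaled:
  assumes ps: "prob_space \<mu>" "prob_space \<nu>" and sets: "sets \<mu> = sets \<nu>"
    and le: "\<And>A. A \<in> sets \<nu> \<Longrightarrow> emeasure \<mu> A \<le> c * emeasure \<nu> A"
    and I: "finite I" and f: "f \<in> borel_measurable (PiM I (\<lambda>_. \<nu>))"
  shows "(\<integral>\<^sup>+x. f x \<partial>PiM I (\<lambda>_. \<mu>)) \<le> c ^ card I * (\<integral>\<^sup>+x. f x \<partial>PiM I (\<lambda>_. \<nu>))"
proof -
  interpret \<mu>: prob_space \<mu> by fact
  interpret \<nu>: prob_space \<nu> by fact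
  interpret P\<mu>: product_sigma_finite "\<lambda>_. \<mu>" by standard
  interpret P\<nu>: product_sigma_finite "\<lambda>_. \<nu>" by standard
  have sets_Pi: "sets (PiM J (\<lambda>_. \<mu>)) = sets (PiM J (\<lambda>_. \<nu>))" for J
    by (intro sets_PiM_cong refl sets)
  show ?thesis using I f
  proof (induction I arbitrary: f)
    case empty
    then show ?case by (simp add: PiM_empty nn_integral_count_space_finite)
  next
    case (insert i I)
    note f = insert.prems
    have f': "f \<in> borel_measurable (PiM (insert i I) (\<lambda>_. \<mu>))"
      using f measurable_cong_sets[OF sets_Pi refl] by blast
    have upd: "(\<lambda>y. f (x(i := y))) \<in> borel_measurable \<nu>" if "x \<in> space (PiM I (\<lambda>_. \<nu>))" for x
      by (rule measurable_compose[OF measurable_component_update[OF that insert.hyps(2)] f])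
    have F: "(\<lambda>x. \<integral>\<^sup>+y. f (x(i := y)) \<partial>\<nu>) \<in> borel_measurable (PiM I (\<lambda>_. \<nu>))"
      by (rule \<nu>.borel_measurable_nn_integral)
         (use measurable_compose[OF measurable_add_dim f] in \<open>simp add: case_prod_unfold fun_upd_def\<close>)
    have "(\<integral>\<^sup>+x. f x \<partial>PiM (insert i I) (\<lambda>_. \<mu>)) = (\<integral>\<^sup>+x. \<integral>\<^sup>+y. f (x(i := y)) \<partial>\<mu> \<partial>PiM I (\<lambda>_. \<mu>))"
      by (rule P\<mu>.product_nn_integral_insert[OF insert.hyps f'])
    also have "\<dots> \<le> (\<integral>\<^sup>+x. c * (\<integral>\<^sup>+y. f (x(i := y)) \<partial>\<nu>) \<partial>PiM I (\<lambda>_. \<mu>))"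
      by (intro nn_integral_mono nn_integral_le_scaled sets le upd)
         (simp_all add: sets_Pi[THEN sets_eq_imp_space_eq])
    also have "\<dots> = c * (\<integral>\<^sup>+x. \<integral>\<^sup>+y. f (x(i := y)) \<partial>\<nu> \<partial>PiM I (\<lambda>_. \<mu>))"
      by (rule nn_integral_cmult) (use F measurable_cong_sets[OF sets_Pi refl] in blast)
    also have "\<dots> \<le> c * (c ^ card I * (\<integral>\<^sup>+x. \<integral>\<^sup>+y. f (x(i := y)) \<partial>\<nu> \<partial>PiM I (\<lambda>_. \<nu>)))"
      by (intro mult_left_mono insert.IH F) simp
    also have "\<dots> = c ^ card (insert i I) * (\<integral>\<^sup>+x. f x \<partial>PiM (insert i I) (\<lambda>_. \<nu>))"
      unfolding P\<nu>.product_nn_integral_insert[OF insert.hyps f] using insert.hyps by (simp add: mult.assoc)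
    finally show ?case .
  qed
qed

lemma emeasure_PiM_le_scaled:
  assumes "prob_space \<mu>" "prob_space \<nu>" "sets \<mu> = sets \<nu>"
    and "\<And>A. A \<in> sets \<nu> \<Longrightarrow> emeasure \<mu> A \<le> c * emeasure \<nu> A"
    and "finite I" and A: "A \<in> sets (PiM I (\<lambda>_. \<nu>))"
  shows "emeasure (PiM I (\<lambda>_. \<mu>)) A \<le> c ^ card I * emeasure (PiM I (\<lambda>_. \<nu>)) A"
proof -
  have "A \<in> sets (PiM I (\<lambda>_. \<mu>))" using A sets_PiM_cong[OF refl assms(3), of I] by simp
  then show ?thesis
    using nn_integral_PiM_le_scaled[OF assms(1-5), of "indicator A"] A by simp
qed

lemma nn_integral_PiM_component:
  assumes "prob_space \<mu>" and i: "i \<in> I" and I: "finite I" and g: "g \<in> borel_measurable \<mu>"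
  shows "(\<integral>\<^sup>+z. g (z i) \<partial>PiM I (\<lambda>_. \<mu>)) = (\<integral>\<^sup>+y. g y \<partial>\<mu>)"
proof -
  interpret prob_space \<mu> by fact
  interpret product_prob_space "\<lambda>_. \<mu>" I by standard
  have "(\<integral>\<^sup>+y. g y \<partial>\<mu>) = (\<integral>\<^sup>+y. g y \<partial>distr (PiM I (\<lambda>_. \<mu>)) \<mu> (\<lambda>z. z i))"
    by (simp add: PiM_component i)
  also have "\<dots> = (\<integral>\<^sup>+z. g (z i) \<partial>PiM I (\<lambda>_. \<mu>))"
    by (rule nn_integral_distr) (use g i in auto)
  finally show ?thesis ..
qed

section \<open>The particle model\<close>

text \<open>\<open>mixture\<close> is given by a set function under \<open>measure_of\<close>, so
  its values are only available once that function is known to be countably additive. Drawing an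
  index with probability proportional to \<open>G\<close> and then moving by \<open>M\<close> is a
  bind, already a measure, with the same values.\<close>

lemma mixture_eq_bind:
  fixes M :: "'w \<times> 'x \<Rightarrow> 'x measure"
  assumes N: "1 \<le> N" and G: "\<And>j. j < N \<Longrightarrow> 0 < G (\<omega>, x j)"
    and M: "\<And>j. j < N \<Longrightarrow> M (\<omega>, x j) \<in> space (prob_algebra X)"
  defines "B \<equiv> density (count_space {..<N}) (\<lambda>j. ennreal (G (\<omega>, x j) / (\<Sum>j<N. G (\<omega>, x j)))) \<bind> (\<lambda>j. M (\<omega>, x j))"
  shows "mixture N X G M (\<omega>, x) = B" and "sets B = sets X" and "prob_space B"
    and "\<And>f. f \<in> borel_measurable X \<Longrightarrow>
      (\<integral>\<^sup>+y. f y \<partial>B) = (\<Sum>j<N. ennreal (G (\<omega>, x j) / (\<Sum>j<N. G (\<omega>, x j))) * (\<integral>\<^sup>+y. f y \<partial>M (\<omega>, x j)))"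
proof -
  let ?s = "\<Sum>j<N. G (\<omega>, x j)"
  let ?D = "density (count_space {..<N}) (\<lambda>j. ennreal (G (\<omega>, x j) / ?s))"
  have s: "0 < ?s" using N G by (intro sum_pos) (auto simp: lessThan_empty_iff)
  have w: "0 \<le> G (\<omega>, x j) / ?s" if "j < N" for j using G[OF that] s by simp
  have sub: "M (\<omega>, x j) \<in> space (subprob_algebra X)" and ps: "prob_space (M (\<omega>, x j))"
    and sM: "sets (M (\<omega>, x j)) = sets X" if "j < N" for j
    using M[OF that] by (auto simp: space_prob_algebra space_subprob_algebra prob_space_imp_subprob_space)
  have k: "(\<lambda>j. M (\<omega>, x j)) \<in> ?D \<rightarrow>\<^sub>M subprob_algebra X" using sub by simp
  have D_ne: "space ?D \<noteq> {}" using N by (auto simp: lessThan_empty_iff)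
  show int: "(\<integral>\<^sup>+y. f y \<partial>B) = (\<Sum>j<N. ennreal (G (\<omega>, x j) / ?s) * (\<integral>\<^sup>+y. f y \<partial>M (\<omega>, x j)))"
    if f: "f \<in> borel_measurable X" for f
    unfolding B_def nn_integral_bind[OF f k]
    by (subst nn_integral_density) (auto simp: nn_integral_count_space_finite)
  show sB: "sets B = sets X"
    unfolding B_def using D_ne sM by (intro sets_bind) auto
  have emB: "emeasure B A = (\<Sum>j<N. ennreal (G (\<omega>, x j) / ?s) * emeasure (M (\<omega>, x j)) A)" if A: "A \<in> sets X" for A
    using int[of "indicator A"] A by (simp add: sB sM)
  have "emeasure B (space X) = 1"
  proof -
    have "emeasure B (space X) = (\<Sum>j<N. ennreal (G (\<omega>, x j) / ?s))"
      unfolding emB[OF sets.top]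
      by (intro sum.cong refl) (use prob_space.emeasure_space_1[OF ps] sets_eq_imp_space_eq[OF sM] in force)
    also have "\<dots> = ennreal (\<Sum>j<N. G (\<omega>, x j) / ?s)" by (rule sum_ennreal) (use w in auto)
    finally show ?thesis using s by (simp flip: sum_divide_distrib)
  qed
  then show "prob_space B" by (intro prob_spaceI) (simp add: sets_eq_imp_space_eq[OF sB])
  have "mixture N X G M (\<omega>, x) = measure_of (space X) (sets X) (emeasure B)"
    unfolding mixture_def prod.case
  proof (rule measure_of_eq[OF sets.space_closed])
    fix A assume "A \<in> sigma_sets (space X) (sets X)"
    then have A: "A \<in> sets X" by (simp add: sets.sigma_sets_eq)
    have "ennreal ((\<Sum>j<N. G (\<omega>, x j) * measure (M (\<omega>, x j)) A) / ?s)
        = ennreal (\<Sum>j<N. G (\<omega>, x j) / ?s * measure (M (\<omega>, x j)) A)"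
      by (simp add: sum_divide_distrib)
    also have "\<dots> = (\<Sum>j<N. ennreal (G (\<omega>, x j) / ?s * measure (M (\<omega>, x j)) A))"
      by (rule sum_ennreal[symmetric]) (intro mult_nonneg_nonneg w, auto)
    also have "\<dots> = emeasure B A"
      unfolding emB[OF A]
    proof (rule sum.cong[OF refl])
      fix j assume "j \<in> {..<N}"
      then have j: "j < N" by simp
      show "ennreal (G (\<omega>, x j) / ?s * measure (M (\<omega>, x j)) A)
          = ennreal (G (\<omega>, x j) / ?s) * emeasure (M (\<omega>, x j)) A"
        using ennreal_mult'[OF w[OF j]] finite_measure.emeasure_eq_measure[OF prob_space.finite_measure[OF ps[OF j]]]
        by simp
    qed
    finally show "ennreal ((\<Sum>j<N. G (\<omega>, x j) * measure (M (\<omega>, x j)) A) / ?s) = emeasure B A" .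
  qed
  also have "\<dots> = B"
    using measure_of_of_measure[of B] sB sets_eq_imp_space_eq[OF sB] by simp
  finally show "mixture N X G M (\<omega>, x) = B" .
qed

locale particle_model =
  fixes W :: "'w measure" and X :: "'x measure" and T :: "'w \<Rightarrow> 'w"
    and M :: "'w \<times> 'x \<Rightarrow> 'x measure" and G :: "'w \<times> 'x \<Rightarrow> real"
    and \<nu> :: "'x measure" and \<beta> \<epsilon>m \<epsilon>p :: real and N :: nat
  assumes T: "T \<in> W \<rightarrow>\<^sub>M W"
    and M: "M \<in> W \<Otimes>\<^sub>M X \<rightarrow>\<^sub>M prob_algebra X"
    and G: "G \<in> borel_measurable (W \<Otimes>\<^sub>M X)"
    and G_pos: "\<And>\<omega> x. \<omega> \<in> space W \<Longrightarrow> x \<in> space X \<Longrightarrow> 0 < G (\<omega>, x)"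
    and \<epsilon>m: "0 < \<epsilon>m" and \<epsilon>p: "0 < \<epsilon>p" and \<beta>: "1 \<le> \<beta>"
    and \<nu>: "prob_space \<nu>" and sets_\<nu>: "sets \<nu> = sets X"
    and G_ratio: "\<And>\<omega> \<omega>' x x'. \<omega> \<in> space W \<Longrightarrow> \<omega>' \<in> space W \<Longrightarrow>
           x \<in> space X \<Longrightarrow> x' \<in> space X \<Longrightarrow> G (\<omega>, x) / G (\<omega>', x') \<le> \<beta>"
    and M_bounds: "\<And>\<omega> x A. \<omega> \<in> space W \<Longrightarrow> x \<in> space X \<Longrightarrow> A \<in> sets X \<Longrightarrow>
           \<epsilon>m * measure \<nu> A \<le> measure (M (\<omega>, x)) A \<and>
           measure (M (\<omega>, x)) A \<le> \<epsilon>p * measure \<nu> A"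
    and N: "1 \<le> N"
begin

abbreviation "XN \<equiv> pow_measure N X"

text \<open>The last argument is a dummy: weights act on pairs of successive states, as the
  numerator needs for \<open>\<phi>\<close>.\<close>

definition weight :: "'w \<times> 'x \<times> 'x \<Rightarrow> ennreal" where
  "weight = (\<lambda>(\<omega>, x, y). ennreal (G (\<omega>, x)))"

definition particle_weight ::
    "('w \<times> (nat \<Rightarrow> 'x) \<times> (nat \<Rightarrow> 'x) \<Rightarrow> ennreal) \<Rightarrow> 'w \<times> (nat \<Rightarrow> 'x) \<times> (nat \<Rightarrow> 'x) \<Rightarrow> ennreal" where
  "particle_weight \<phi> = (\<lambda>(\<omega>, x, y). (ennreal (particle_potential N G (\<omega>, x)))\<^sup>2 * (\<phi> (\<omega>, x, y))\<^sup>2)"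

lemma space_\<nu>: "space \<nu> = space X"
  using sets_\<nu> sets_eq_imp_space_eq by blast

lemma component_space: "x \<in> space XN \<Longrightarrow> j < N \<Longrightarrow> x j \<in> space X"
  by (auto simp: space_PiM)

lemma M_prob_algebra: "\<omega> \<in> space W \<Longrightarrow> x \<in> space X \<Longrightarrow> M (\<omega>, x) \<in> space (prob_algebra X)"
  using measurable_space[OF M] by (simp add: space_pair_measure)

lemma M_emeasure_bounds:
  assumes "\<omega> \<in> space W" "x \<in> space X" "A \<in> sets X"
  shows "emeasure (M (\<omega>, x)) A \<le> ennreal \<epsilon>p * emeasure \<nu> A"
    and "ennreal \<epsilon>m * emeasure \<nu> A \<le> emeasure (M (\<omega>, x)) A"
proof -
  interpret \<nu>: prob_space \<nu> by (rule \<nu>)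
  interpret M: prob_space "M (\<omega>, x)" using M_prob_algebra[OF assms(1,2)] by (simp add: space_prob_algebra)
  show "emeasure (M (\<omega>, x)) A \<le> ennreal \<epsilon>p * emeasure \<nu> A"
    and "ennreal \<epsilon>m * emeasure \<nu> A \<le> emeasure (M (\<omega>, x)) A"
    using M_bounds[OF assms] \<epsilon>m \<epsilon>p
    by (simp_all add: M.emeasure_eq_measure \<nu>.emeasure_eq_measure ennreal_mult'[symmetric])
qed

text \<open>The ratio condition, used in both directions against one reference value
  \<open>?g\<close>, gives \<open>?g / \<beta>\<close> and \<open>\<beta> * ?g\<close>. Over an
  empty environment space the bounds are vacuous and 1 serves.\<close>

lemma G_bounds:
  obtains gl gu where "0 < gl" "0 < gu"
    "\<And>\<omega> x. \<omega> \<in> space W \<Longrightarrow> x \<in> space X \<Longrightarrow> gl \<le> G (\<omega>, x) \<and> G (\<omega>, x) \<le> gu"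
proof (cases "space W = {}")
  case True
  then show ?thesis by (intro that[of 1 1]) auto
next
  case False
  then obtain \<omega>0 where \<omega>0: "\<omega>0 \<in> space W" by blast
  obtain x0 where x0: "x0 \<in> space X" using prob_space.not_empty[OF \<nu>] space_\<nu> by blast
  let ?g = "G (\<omega>0, x0)"
  have g: "0 < ?g" by (rule G_pos[OF \<omega>0 x0])
  have "?g / \<beta> \<le> G (\<omega>, x) \<and> G (\<omega>, x) \<le> \<beta> * ?g" if "\<omega> \<in> space W" "x \<in> space X" for \<omega> x
    using G_ratio[OF that(1) \<omega>0 that(2) x0] G_ratio[OF \<omega>0 that(1) x0 that(2)] g G_pos[OF that] \<beta>
    by (simp add: field_simps)
  then show ?thesis using g \<beta> by (intro that[of "?g / \<beta>" "\<beta> * ?g"]) auto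
qed

lemma random_weighted_kernel_weight:
  obtains a b where "random_weighted_kernel W X T M weight \<nu> a b"
proof -
  obtain gl gu where g: "0 < gl" "0 < gu"
    "\<And>\<omega> x. \<omega> \<in> space W \<Longrightarrow> x \<in> space X \<Longrightarrow> gl \<le> G (\<omega>, x) \<and> G (\<omega>, x) \<le> gu" by (rule G_bounds) blast
  have "random_weighted_kernel W X T M weight \<nu> (gl * \<epsilon>m) (gu * \<epsilon>p)"
  proof (rule random_weighted_kernel.intro)
    note G[measurable]
    show "weight \<in> borel_measurable (W \<Otimes>\<^sub>M (X \<Otimes>\<^sub>M X))" unfolding weight_def by measurable
    show "finite_measure \<nu>" by (rule prob_space.finite_measure[OF \<nu>])
    show "0 < emeasure \<nu> (space \<nu>)" using prob_space.emeasure_space_1[OF \<nu>] by simp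
    fix \<omega> x and f :: "'x \<Rightarrow> ennreal" assume A: "\<omega> \<in> space W" "x \<in> space X" and f: "f \<in> borel_measurable X"
    have sM: "sets (M (\<omega>, x)) = sets X" using M_prob_algebra[OF A] by (simp add: space_prob_algebra)
    have fM: "f \<in> borel_measurable (M (\<omega>, x))" and f\<nu>: "f \<in> borel_measurable \<nu>"
      using f measurable_cong_sets[OF sM refl] measurable_cong_sets[OF sets_\<nu> refl] by blast+
    have eq: "weighted_op M weight \<omega> f x = ennreal (G (\<omega>, x)) * (\<integral>\<^sup>+y. f y \<partial>M (\<omega>, x))"
      unfolding weighted_op_def weight_def by (simp add: nn_integral_cmult[OF fM])
    have up: "(\<integral>\<^sup>+y. f y \<partial>M (\<omega>, x)) \<le> ennreal \<epsilon>p * (\<integral>\<^sup>+y. f y \<partial>\<nu>)"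
      by (rule nn_integral_le_scaled) (use M_emeasure_bounds[OF A] sM sets_\<nu> f\<nu> in auto)
    have "(\<integral>\<^sup>+y. f y \<partial>\<nu>) \<le> ennreal (1 / \<epsilon>m) * (\<integral>\<^sup>+y. f y \<partial>M (\<omega>, x))"
      by (rule nn_integral_le_scaled)
         (use M_emeasure_bounds(2)[OF A] ennreal_mult_cancel_left_le[OF \<epsilon>m, of _ 1] sM sets_\<nu> fM in auto)
    then have "ennreal \<epsilon>m * (\<integral>\<^sup>+y. f y \<partial>\<nu>) \<le> ennreal \<epsilon>m * (ennreal (1 / \<epsilon>m) * (\<integral>\<^sup>+y. f y \<partial>M (\<omega>, x)))"
      by (rule mult_left_mono) simp
    also have "\<dots> = (\<integral>\<^sup>+y. f y \<partial>M (\<omega>, x))"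
      using \<epsilon>m ennreal_mult'[of \<epsilon>m "1 / \<epsilon>m"] by (simp add: mult.assoc[symmetric])
    finally have lo: "ennreal \<epsilon>m * (\<integral>\<^sup>+y. f y \<partial>\<nu>) \<le> (\<integral>\<^sup>+y. f y \<partial>M (\<omega>, x))" .
    show "ennreal (gl * \<epsilon>m) * (\<integral>\<^sup>+y. f y \<partial>\<nu>) \<le> weighted_op M weight \<omega> f x"
      unfolding eq using g A \<epsilon>m lo by (auto simp: ennreal_mult' mult.assoc intro!: mult_mono ennreal_leI)
    show "weighted_op M weight \<omega> f x \<le> ennreal (gu * \<epsilon>p) * (\<integral>\<^sup>+y. f y \<partial>\<nu>)"
      unfolding eq using g A \<epsilon>p up by (auto simp: ennreal_mult' mult.assoc intro!: mult_mono ennreal_leI)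
  qed (use T M sets_\<nu> g \<epsilon>m \<epsilon>p in auto)
  then show ?thesis by (rule that)
qed

lemma
  assumes \<omega>: "\<omega> \<in> space W" and x: "x \<in> space XN"
  shows sets_mixture: "sets (mixture N X G M (\<omega>, x)) = sets X"
    and prob_space_mixture: "prob_space (mixture N X G M (\<omega>, x))"
    and nn_integral_mixture: "f \<in> borel_measurable X \<Longrightarrow> (\<integral>\<^sup>+y. f y \<partial>mixture N X G M (\<omega>, x)) =
      (\<Sum>j<N. ennreal (G (\<omega>, x j) / (\<Sum>j<N. G (\<omega>, x j))) * (\<integral>\<^sup>+y. f y \<partial>M (\<omega>, x j)))"
proof -
  note B = mixture_eq_bind[OF N, of G \<omega> x M X, OF G_pos[OF \<omega> component_space[OF x]]
      M_prob_algebra[OF \<omega> component_space[OF x]]]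
  show "sets (mixture N X G M (\<omega>, x)) = sets X" "prob_space (mixture N X G M (\<omega>, x))"
    using B by simp_all
  show "(\<integral>\<^sup>+y. f y \<partial>mixture N X G M (\<omega>, x)) =
      (\<Sum>j<N. ennreal (G (\<omega>, x j) / (\<Sum>j<N. G (\<omega>, x j))) * (\<integral>\<^sup>+y. f y \<partial>M (\<omega>, x j)))"
    if "f \<in> borel_measurable X" using B that by simp
qed

lemma mixture_bounds:
  assumes \<omega>: "\<omega> \<in> space W" and x: "x \<in> space XN" and A: "A \<in> sets X"
  shows "emeasure (mixture N X G M (\<omega>, x)) A \<le> ennreal \<epsilon>p * emeasure \<nu> A"
    and "emeasure \<nu> A \<le> ennreal (1 / \<epsilon>m) * emeasure (mixture N X G M (\<omega>, x)) A"
proof -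
  let ?B = "mixture N X G M (\<omega>, x)"
  let ?w = "\<lambda>j. ennreal (G (\<omega>, x j) / (\<Sum>j<N. G (\<omega>, x j)))"
  have sM: "sets (M (\<omega>, x j)) = sets X" "prob_space (M (\<omega>, x j))" if "j < N" for j
    using M_prob_algebra[OF \<omega> component_space[OF x that]] by (simp_all add: space_prob_algebra)
  \<comment> \<open>That the selection weights sum to one is read off from the total mass of the
    mixture; the bounds for \<open>M\<close> then pass to a convex combination.\<close>
  have "1 = (\<integral>\<^sup>+y. 1 \<partial>?B)"
    using prob_space.emeasure_space_1[OF prob_space_mixture[OF \<omega> x]] by simp
  also have "\<dots> = (\<Sum>j<N. ?w j)"
    using nn_integral_mixture[OF \<omega> x, of "\<lambda>_. 1"] prob_space.emeasure_space_1[OF sM(2)] by simp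
  finally have w: "(\<Sum>j<N. ?w j) = 1" ..
  have em: "emeasure ?B A = (\<Sum>j<N. ?w j * emeasure (M (\<omega>, x j)) A)"
    using nn_integral_mixture[OF \<omega> x, of "indicator A"] A by (simp add: sets_mixture[OF \<omega> x] sM)
  have "emeasure ?B A \<le> (\<Sum>j<N. ?w j * (ennreal \<epsilon>p * emeasure \<nu> A))"
    unfolding em by (intro sum_mono mult_left_mono M_emeasure_bounds \<omega> component_space[OF x] A) auto
  then show "emeasure ?B A \<le> ennreal \<epsilon>p * emeasure \<nu> A"
    unfolding sum_distrib_right[symmetric] w by simp
  have "(\<Sum>j<N. ?w j * (ennreal \<epsilon>m * emeasure \<nu> A)) \<le> emeasure ?B A"
    unfolding em by (intro sum_mono mult_left_mono M_emeasure_bounds \<omega> component_space[OF x] A) auto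
  then have "ennreal \<epsilon>m * emeasure \<nu> A \<le> ennreal 1 * emeasure ?B A"
    unfolding sum_distrib_right[symmetric] w by simp
  then show "emeasure \<nu> A \<le> ennreal (1 / \<epsilon>m) * emeasure ?B A"
    by (rule ennreal_mult_cancel_left_le[OF \<epsilon>m])
qed

lemma sets_pow_\<nu>: "sets (pow_measure N \<nu>) = sets XN"
  by (intro sets_PiM_cong refl sets_\<nu>)

text \<open>The bounds for one mixture are raised to the power \<open>N\<close> by the product
  structure. Since they compare with \<open>\<nu>\<close>, they are uniform in the environment and
  the particle positions.\<close>

lemma particle_kernel_bounds:
  assumes \<omega>: "\<omega> \<in> space W" and x: "x \<in> space XN" and A: "A \<in> sets XN"
  shows "emeasure (particle_kernel N X G M (\<omega>, x)) A \<le> ennreal (\<epsilon>p ^ N) * emeasure (pow_measure N \<nu>) A"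
    and "emeasure (pow_measure N \<nu>) A \<le> ennreal ((1 / \<epsilon>m) ^ N) * emeasure (particle_kernel N X G M (\<omega>, x)) A"
proof -
  have s: "sets (mixture N X G M (\<omega>, x)) = sets \<nu>" by (simp add: sets_mixture[OF \<omega> x] sets_\<nu>)
  have s': "sets (PiM {..<N} (\<lambda>_. mixture N X G M (\<omega>, x))) = sets XN"
    by (intro sets_PiM_cong refl sets_mixture \<omega> x)
  show "emeasure (particle_kernel N X G M (\<omega>, x)) A \<le> ennreal (\<epsilon>p ^ N) * emeasure (pow_measure N \<nu>) A"
    using emeasure_PiM_le_scaled[OF prob_space_mixture[OF \<omega> x] \<nu> s mixture_bounds(1)[OF \<omega> x], of "{..<N}" A]
      A sets_\<nu> sets_pow_\<nu> \<epsilon>p by (simp add: particle_kernel_def ennreal_power)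
  show "emeasure (pow_measure N \<nu>) A \<le> ennreal ((1 / \<epsilon>m) ^ N) * emeasure (particle_kernel N X G M (\<omega>, x)) A"
    using emeasure_PiM_le_scaled[OF \<nu> prob_space_mixture[OF \<omega> x] s[symmetric] mixture_bounds(2)[OF \<omega> x], of "{..<N}" A]
      A s' sets_mixture[OF \<omega> x] \<epsilon>m by (simp add: particle_kernel_def ennreal_power)
qed

lemma prob_space_particle_kernel:
  "\<omega> \<in> space W \<Longrightarrow> x \<in> space XN \<Longrightarrow> prob_space (particle_kernel N X G M (\<omega>, x))"
  by (simp add: particle_kernel_def prob_space_PiM prob_space_mixture)

lemma sets_particle_kernel:
  "\<omega> \<in> space W \<Longrightarrow> x \<in> space XN \<Longrightarrow> sets (particle_kernel N X G M (\<omega>, x)) = sets XN"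
  unfolding particle_kernel_def prod.case by (intro sets_PiM_cong refl sets_mixture)

lemma measurable_particle_weight:
  assumes \<phi>: "\<phi> \<in> borel_measurable (W \<Otimes>\<^sub>M (XN \<Otimes>\<^sub>M XN))"
  shows "particle_weight \<phi> \<in> borel_measurable (W \<Otimes>\<^sub>M (XN \<Otimes>\<^sub>M XN))"
proof -
  note \<phi>[measurable]
  have G': "(\<lambda>z. G (fst z, fst (snd z) i)) \<in> borel_measurable (W \<Otimes>\<^sub>M (XN \<Otimes>\<^sub>M XN))" if i: "i < N" for i
  proof (rule measurable_compose[OF _ G])
    have [measurable]: "(\<lambda>x. x i) \<in> XN \<rightarrow>\<^sub>M X" using i by (intro measurable_component_singleton) simp
    show "(\<lambda>z. (fst z, fst (snd z) i)) \<in> W \<Otimes>\<^sub>M (XN \<Otimes>\<^sub>M XN) \<rightarrow>\<^sub>M W \<Otimes>\<^sub>M X" by measurable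
  qed
  have [measurable]: "(\<lambda>z. (\<Sum>i<N. G (fst z, fst (snd z) i))) \<in> borel_measurable (W \<Otimes>\<^sub>M (XN \<Otimes>\<^sub>M XN))"
    by (intro borel_measurable_sum G') simp
  have "particle_weight \<phi> = (\<lambda>z. (ennreal ((\<Sum>i<N. G (fst z, fst (snd z) i)) / real N))\<^sup>2 * (\<phi> z)\<^sup>2)"
    by (auto simp: particle_weight_def particle_potential_def fun_eq_iff)
  then show ?thesis by simp
qed

lemma particle_potential_bounds:
  assumes "\<And>x. x \<in> space X \<Longrightarrow> gl \<le> G (\<omega>, x) \<and> G (\<omega>, x) \<le> gu" and x: "x \<in> space XN"
  shows "gl \<le> particle_potential N G (\<omega>, x)" and "particle_potential N G (\<omega>, x) \<le> gu"
proof -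
  have "(\<Sum>i<N. gl) \<le> (\<Sum>i<N. G (\<omega>, x i))" "(\<Sum>i<N. G (\<omega>, x i)) \<le> (\<Sum>i<N. gu)"
    by (intro sum_mono; use assms component_space in force)+
  then show "gl \<le> particle_potential N G (\<omega>, x)" "particle_potential N G (\<omega>, x) \<le> gu"
    using N by (simp_all add: particle_potential_def field_simps)
qed

text \<open>Here the conditions defining \<open>admissible_kernels\<close> enter: the bounds by
  \<open>em\<close> and \<open>ep\<close> and the bounds on the particle kernel control the squared
  weight, and square integrability makes \<open>\<rho>\<close> finite. The factors
  \<open>gl\<^sup>2\<close> and \<open>gu\<^sup>2\<close> come from the squared potential.\<close>

lemma random_weighted_kernel_particle:
  assumes K: "K \<in> admissible_kernels W X \<nu> N"
    and \<phi>: "RN_version W XN K (particle_kernel N X G M) \<phi>"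
  obtains \<rho> a b where "random_weighted_kernel W XN T K (particle_weight \<phi>) \<rho> a b"
proof -
  obtain gl gu where g: "0 < gl" "0 < gu"
    "\<And>\<omega> x. \<omega> \<in> space W \<Longrightarrow> x \<in> space X \<Longrightarrow> gl \<le> G (\<omega>, x) \<and> G (\<omega>, x) \<le> gu" by (rule G_bounds) blast
  have Km: "K \<in> W \<Otimes>\<^sub>M XN \<rightarrow>\<^sub>M prob_algebra XN" using K by (simp add: admissible_kernels_def)
  obtain em ep \<nu>' where e: "0 < em" "0 < ep" and \<nu>': "prob_space \<nu>'" "sets \<nu>' = sets XN"
    and K_bounds: "\<And>\<omega> x A. \<omega> \<in> space W \<Longrightarrow> x \<in> space XN \<Longrightarrow> A \<in> sets XN \<Longrightarrow>
          em * measure \<nu>' A \<le> measure (K (\<omega>, x)) A \<and> measure (K (\<omega>, x)) A \<le> ep * measure \<nu>' A"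
    and ac: "absolutely_continuous \<nu>' (pow_measure N \<nu>)"
    and fin: "(\<integral>\<^sup>+x. (RN_deriv \<nu>' (pow_measure N \<nu>) x)\<^sup>2 \<partial>\<nu>') < \<infinity>"
    using K unfolding admissible_kernels_def by blast
  interpret \<nu>': prob_space \<nu>' by (rule \<nu>'(1))
  have \<phi>m: "\<phi> \<in> borel_measurable (W \<Otimes>\<^sub>M (XN \<Otimes>\<^sub>M XN))"
    and \<phi>d: "\<And>\<omega> x. \<omega> \<in> space W \<Longrightarrow> x \<in> space XN \<Longrightarrow>
      density (K (\<omega>, x)) (\<lambda>x'. \<phi> (\<omega>, x, x')) = particle_kernel N X G M (\<omega>, x)"
    using \<phi> unfolding RN_version_def by blast+
  let ?r = "RN_deriv \<nu>' (pow_measure N \<nu>)"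
  define \<rho> where "\<rho> = density \<nu>' (\<lambda>x. (?r x)\<^sup>2)"
  have p\<nu>: "prob_space (pow_measure N \<nu>)" by (intro prob_space_PiM \<nu>)
  have s\<nu>: "sets (pow_measure N \<nu>) = sets \<nu>'" by (simp add: sets_pow_\<nu> \<nu>')
  have \<rho>_mass: "emeasure \<rho> (space \<rho>) = (\<integral>\<^sup>+x. (?r x)\<^sup>2 \<partial>\<nu>')"
    unfolding \<rho>_def by (simp add: emeasure_density)
  \<comment> \<open>A vanishing mass would make the density zero almost everywhere and turn a
    probability measure into the zero measure.\<close>
  have \<rho>_pos: "(\<integral>\<^sup>+x. (?r x)\<^sup>2 \<partial>\<nu>') \<noteq> 0"
  proof
    assume "(\<integral>\<^sup>+x. (?r x)\<^sup>2 \<partial>\<nu>') = 0"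
    then have "AE x in \<nu>'. (?r x)\<^sup>2 = 0" by (subst (asm) nn_integral_0_iff_AE) auto
    then have "density \<nu>' ?r = density \<nu>' (\<lambda>_. 0)"
      by (intro density_cong) (auto simp: power2_eq_square elim: eventually_mono)
    then have "emeasure (pow_measure N \<nu>) (space \<nu>') = 0"
      by (simp add: \<nu>'.density_RN_deriv[OF ac s\<nu>] emeasure_density)
    then show False using prob_space.emeasure_space_1[OF p\<nu>] sets_eq_imp_space_eq[OF s\<nu>] by simp
  qed
  let ?cu = "\<epsilon>p ^ N" and ?cl = "(1 / \<epsilon>m) ^ N"
  have "random_weighted_kernel W XN T K (particle_weight \<phi>) \<rho> (gl\<^sup>2 * (1 / (?cl\<^sup>2 * ep))) (gu\<^sup>2 * (?cu\<^sup>2 / em))"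
  proof (rule random_weighted_kernel.intro)
    show "particle_weight \<phi> \<in> borel_measurable (W \<Otimes>\<^sub>M (XN \<Otimes>\<^sub>M XN))"
      by (rule measurable_particle_weight[OF \<phi>m])
    show "finite_measure \<rho>" by (rule finite_measureI) (use fin \<rho>_mass in auto)
    show "0 < emeasure \<rho> (space \<rho>)" using \<rho>_pos \<rho>_mass by (simp add: zero_less_iff_neq_zero)
    show "sets \<rho> = sets XN" by (simp add: \<rho>_def \<nu>')
    show "0 < gl\<^sup>2 * (1 / (?cl\<^sup>2 * ep))" "0 < gu\<^sup>2 * (?cu\<^sup>2 / em)" using g e \<epsilon>m \<epsilon>p by auto
    fix \<omega> x and f :: "(nat \<Rightarrow> 'x) \<Rightarrow> ennreal"
    assume \<omega>: "\<omega> \<in> space W" and x: "x \<in> space XN" and f: "f \<in> borel_measurable XN"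
    have K: "prob_space (K (\<omega>, x))" "sets (K (\<omega>, x)) = sets \<nu>'"
      using measurable_space[OF Km, of "(\<omega>, x)"] \<omega> x by (auto simp: space_pair_measure space_prob_algebra \<nu>')
    have f': "f \<in> borel_measurable \<nu>'" using f measurable_cong_sets[OF \<nu>'(2) refl] by blast
    have \<phi>': "(\<lambda>y. \<phi> (\<omega>, x, y)) \<in> borel_measurable \<nu>'"
      using measurable_compose[OF measurable_Pair[OF measurable_const[OF \<omega>] measurable_Pair1'[OF x]] \<phi>m]
        measurable_cong_sets[OF \<nu>'(2) refl] by blast
    have L: "prob_space (particle_kernel N X G M (\<omega>, x))" "sets (particle_kernel N X G M (\<omega>, x)) = sets \<nu>'"
      using prob_space_particle_kernel[OF \<omega> x] sets_particle_kernel[OF \<omega> x] by (simp_all add: \<nu>')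
    have pos: "0 < ?cu" "0 < ?cl" using \<epsilon>m \<epsilon>p by auto
    have bounds: "(\<integral>\<^sup>+y. (\<phi> (\<omega>, x, y))\<^sup>2 * f y \<partial>K (\<omega>, x)) \<le> ennreal (?cu\<^sup>2 / em) * (\<integral>\<^sup>+y. f y \<partial>\<rho>)"
      "ennreal (1 / (?cl\<^sup>2 * ep)) * (\<integral>\<^sup>+y. f y \<partial>\<rho>) \<le> (\<integral>\<^sup>+y. (\<phi> (\<omega>, x, y))\<^sup>2 * f y \<partial>K (\<omega>, x))"
      using nn_integral_squared_density_bounds[OF \<nu>'(1) K(1) L(1) p\<nu> K(2) s\<nu> L(2) e pos _ _ _ _ ac \<phi>' \<phi>d[OF \<omega> x] f']
        K_bounds[OF \<omega> x] particle_kernel_bounds[OF \<omega> x]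
      unfolding \<rho>_def \<nu>'(2) by auto
    let ?p = "particle_potential N G (\<omega>, x)"
    have p: "gl \<le> ?p" "?p \<le> gu" using particle_potential_bounds[of gl \<omega> gu x] g(3)[OF \<omega>] x by blast+
    have p2: "ennreal (gl\<^sup>2) \<le> (ennreal ?p)\<^sup>2" "(ennreal ?p)\<^sup>2 \<le> ennreal (gu\<^sup>2)"
      using p g by (simp_all add: ennreal_power power_mono)
    have fK: "(\<lambda>y. (\<phi> (\<omega>, x, y))\<^sup>2 * f y) \<in> borel_measurable (K (\<omega>, x))"
    proof -
      note f'[measurable] \<phi>'[measurable] K(2)[measurable_cong]
      show ?thesis by measurable
    qed
    have eq: "weighted_op K (particle_weight \<phi>) \<omega> f x
        = (ennreal ?p)\<^sup>2 * (\<integral>\<^sup>+y. (\<phi> (\<omega>, x, y))\<^sup>2 * f y \<partial>K (\<omega>, x))"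
      unfolding weighted_op_def particle_weight_def by (simp add: nn_integral_cmult[OF fK] mult.assoc)
    have "ennreal (gl\<^sup>2 * (1 / (?cl\<^sup>2 * ep))) * (\<integral>\<^sup>+y. f y \<partial>\<rho>)
        = ennreal (gl\<^sup>2) * (ennreal (1 / (?cl\<^sup>2 * ep)) * (\<integral>\<^sup>+y. f y \<partial>\<rho>))"
      using g by (subst ennreal_mult') (simp_all add: mult.assoc)
    also have "\<dots> \<le> weighted_op K (particle_weight \<phi>) \<omega> f x"
      unfolding eq by (intro mult_mono p2 bounds) simp_all
    finally show "ennreal (gl\<^sup>2 * (1 / (?cl\<^sup>2 * ep))) * (\<integral>\<^sup>+y. f y \<partial>\<rho>) \<le> weighted_op K (particle_weight \<phi>) \<omega> f x" .
    have "weighted_op K (particle_weight \<phi>) \<omega> f x \<le> ennreal (gu\<^sup>2) * (ennreal (?cu\<^sup>2 / em) * (\<integral>\<^sup>+y. f y \<partial>\<rho>))"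
      unfolding eq by (intro mult_mono p2 bounds) simp_all
    also have "\<dots> = ennreal (gu\<^sup>2 * (?cu\<^sup>2 / em)) * (\<integral>\<^sup>+y. f y \<partial>\<rho>)"
      using g by (subst ennreal_mult') (simp_all add: mult.assoc)
    finally show "weighted_op K (particle_weight \<phi>) \<omega> f x \<le> ennreal (gu\<^sup>2 * (?cu\<^sup>2 / em)) * (\<integral>\<^sup>+y. f y \<partial>\<rho>)" .
  qed (use T Km in auto)
  then show ?thesis by (rule that)
qed

text \<open>Densities of the same measure agree almost everywhere. The exceptional set depends on
  \<open>\<omega>\<close> and \<open>x\<close>, but it is null for \<open>K (\<omega>, x)\<close>,
  the very measure integrated against.\<close>

lemma weighted_op_RN_version_unique:
  assumes K: "K \<in> W \<Otimes>\<^sub>M XN \<rightarrow>\<^sub>M prob_algebra XN"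
    and \<phi>: "RN_version W XN K L \<phi>" "RN_version W XN K L \<psi>"
    and \<omega>: "\<omega> \<in> space W" and x: "x \<in> space XN"
  shows "weighted_op K (particle_weight \<phi>) \<omega> f x = weighted_op K (particle_weight \<psi>) \<omega> f x"
proof -
  have "K (\<omega>, x) \<in> space (prob_algebra XN)"
    using measurable_space[OF K, of "(\<omega>, x)"] \<omega> x by (simp add: space_pair_measure)
  then have sK: "sets (K (\<omega>, x)) = sets XN" and pK: "prob_space (K (\<omega>, x))" by (auto simp: space_prob_algebra)
  interpret K: prob_space "K (\<omega>, x)" by (rule pK)
  have m: "(\<lambda>y. \<eta> (\<omega>, x, y)) \<in> borel_measurable (K (\<omega>, x))" if "RN_version W XN K L \<eta>" for \<eta>
    using measurable_compose[OF measurable_Pair[OF measurable_const[OF \<omega>] measurable_Pair1'[OF x]]] that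
      measurable_cong_sets[OF sK refl]
    unfolding RN_version_def by blast
  have "AE y in K (\<omega>, x). \<phi> (\<omega>, x, y) = \<psi> (\<omega>, x, y)"
    using \<phi> \<omega> x by (intro K.density_unique m) (auto simp: RN_version_def)
  then show ?thesis
    unfolding weighted_op_def particle_weight_def
    by (intro nn_integral_cong_AE) (auto elim: eventually_mono)
qed

section \<open>Unbiasedness, second moments and the limit of the relative variance\<close>

abbreviation "growth \<equiv> \<lambda>n \<omega>. weighted_ops T M weight n \<omega> (\<lambda>_. 1)"

lemma measurable_growth: "\<omega> \<in> space W \<Longrightarrow> growth n \<omega> \<in> borel_measurable X"
proof -
  assume \<omega>: "\<omega> \<in> space W"
  obtain a b where "random_weighted_kernel W X T M weight \<nu> a b" by (rule random_weighted_kernel_weight)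
  then interpret random_weighted_kernel W X T M weight \<nu> a b .
  show ?thesis by (rule measurable_Qs[OF _ \<omega>]) simp
qed

text \<open>All new particles have the same law, so averaging over them integrates \<open>f\<close>
  against one mixture; the normalising sum of that mixture cancels against the potential.\<close>

lemma particle_unbiased:
  assumes \<omega>: "\<omega> \<in> space W" and x: "x \<in> space XN" and f: "f \<in> borel_measurable X"
  shows "ennreal (particle_potential N G (\<omega>, x)) *
      (\<integral>\<^sup>+y. ennreal (1 / N) * (\<Sum>i<N. f (y i)) \<partial>particle_kernel N X G M (\<omega>, x))
    = ennreal (1 / N) * (\<Sum>i<N. weighted_op M weight \<omega> f (x i))"
proof -
  let ?m = "mixture N X G M (\<omega>, x)" and ?s = "\<Sum>j<N. G (\<omega>, x j)"
  have fm: "f \<in> borel_measurable ?m" using f measurable_cong_sets[OF sets_mixture[OF \<omega> x] refl] by blast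
  have Gx: "0 < G (\<omega>, x j)" if "j < N" for j by (rule G_pos[OF \<omega> component_space[OF x that]])
  have s: "0 < ?s" using N Gx by (intro sum_pos) (auto simp: lessThan_empty_iff)
  have comp: "(\<integral>\<^sup>+y. f (y i) \<partial>particle_kernel N X G M (\<omega>, x)) = (\<integral>\<^sup>+y. f y \<partial>?m)" if "i < N" for i
    unfolding particle_kernel_def prod.case
    by (rule nn_integral_PiM_component[OF prob_space_mixture[OF \<omega> x] _ _ fm]) (use that in auto)
  have fi: "(\<lambda>y. f (y i)) \<in> borel_measurable (particle_kernel N X G M (\<omega>, x))" if "i < N" for i
    unfolding particle_kernel_def prod.case
    by (rule measurable_compose[OF _ fm]) (use that in \<open>auto intro: measurable_component_singleton\<close>)
  have N1: "ennreal (1 / N) * of_nat N = 1"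
    using N ennreal_mult'[of "1 / real N" "real N"] by (simp add: ennreal_of_nat_eq_real_of_nat)
  have "(\<integral>\<^sup>+y. ennreal (1 / N) * (\<Sum>i<N. f (y i)) \<partial>particle_kernel N X G M (\<omega>, x))
      = ennreal (1 / N) * (\<Sum>i<N. \<integral>\<^sup>+y. f (y i) \<partial>particle_kernel N X G M (\<omega>, x))"
    using fi nn_integral_sum[of "{..<N}" "\<lambda>i y. f (y i)" "particle_kernel N X G M (\<omega>, x)"]
    by (subst nn_integral_cmult) (auto intro!: borel_measurable_sum)
  also have "\<dots> = (ennreal (1 / N) * of_nat N) * (\<integral>\<^sup>+y. f y \<partial>?m)"
    by (simp add: comp mult.assoc)
  also have "\<dots> = (\<Sum>j<N. ennreal (G (\<omega>, x j) / ?s) * (\<integral>\<^sup>+y. f y \<partial>M (\<omega>, x j)))"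
    unfolding N1 nn_integral_mixture[OF \<omega> x f] by simp
  finally have "ennreal (particle_potential N G (\<omega>, x)) *
      (\<integral>\<^sup>+y. ennreal (1 / N) * (\<Sum>i<N. f (y i)) \<partial>particle_kernel N X G M (\<omega>, x))
      = (\<Sum>j<N. ennreal (?s / N) * (ennreal (G (\<omega>, x j) / ?s) * (\<integral>\<^sup>+y. f y \<partial>M (\<omega>, x j))))"
    by (simp add: particle_potential_def sum_distrib_left)
  also have "\<dots> = (\<Sum>j<N. ennreal (1 / N) * weighted_op M weight \<omega> f (x j))"
  proof (rule sum.cong[OF refl])
    fix j assume "j \<in> {..<N}"
    then have j: "j < N" by simp
    have sM: "sets (M (\<omega>, x j)) = sets X"
      using M_prob_algebra[OF \<omega> component_space[OF x j]] by (simp add: space_prob_algebra)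
    have fM: "f \<in> borel_measurable (M (\<omega>, x j))" using f measurable_cong_sets[OF sM refl] by blast
    have "weighted_op M weight \<omega> f (x j) = ennreal (G (\<omega>, x j)) * (\<integral>\<^sup>+y. f y \<partial>M (\<omega>, x j))"
      unfolding weighted_op_def weight_def by (simp add: nn_integral_cmult[OF fM])
    moreover have "ennreal (?s / N) * ennreal (G (\<omega>, x j) / ?s) = ennreal (1 / N) * ennreal (G (\<omega>, x j))"
      using s Gx[OF j] ennreal_mult'[of "?s / N" "G (\<omega>, x j) / ?s"] ennreal_mult'[of "1 / N" "G (\<omega>, x j)"] by simp
    ultimately show "ennreal (?s / N) * (ennreal (G (\<omega>, x j) / ?s) * (\<integral>\<^sup>+y. f y \<partial>M (\<omega>, x j)))
        = ennreal (1 / N) * weighted_op M weight \<omega> f (x j)"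
      by (simp add: mult.assoc[symmetric])
  qed
  finally show ?thesis by (simp add: sum_distrib_left)
qed

text \<open>The left side is the squared mean of an unbiased estimator, the right side its second
  moment. Unbiasedness exposes the first step, \<open>\<phi>\<close> changes the particle kernel to
  \<open>K\<close>, Cauchy-Schwarz against the constant 1 moves the square inside, and the induction
  hypothesis bounds the remaining factor.\<close>

lemma particle_second_moment:
  assumes K: "K \<in> W \<Otimes>\<^sub>M XN \<rightarrow>\<^sub>M prob_algebra XN"
    and \<phi>: "RN_version W XN K (particle_kernel N X G M) \<phi>"
    and \<omega>: "\<omega> \<in> space W" and x: "x \<in> space XN"
  shows "(ennreal (1 / N) * (\<Sum>i<N. growth n \<omega> (x i)))\<^sup>2 \<le> weighted_ops T K (particle_weight \<phi>) n \<omega> (\<lambda>_. 1) x"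
  using \<omega> x
proof (induction n arbitrary: \<omega> x)
  case 0
  have "ennreal (1 / N) * of_nat N = 1"
    using N ennreal_mult'[of "1 / real N" "real N"] by (simp add: ennreal_of_nat_eq_real_of_nat)
  then show ?case by simp
next
  case (Suc n)
  note \<omega> = Suc.prems(1) and x = Suc.prems(2)
  have T\<omega>: "T \<omega> \<in> space W" by (rule measurable_space[OF T \<omega>])
  have K': "prob_space (K (\<omega>, x))" "sets (K (\<omega>, x)) = sets XN"
    using measurable_space[OF K, of "(\<omega>, x)"] \<omega> x by (auto simp: space_pair_measure space_prob_algebra)
  interpret K: prob_space "K (\<omega>, x)" by (rule K'(1))
  let ?p = "ennreal (particle_potential N G (\<omega>, x))"
  let ?k = "\<lambda>y. ennreal (1 / N) * (\<Sum>i<N. growth n (T \<omega>) (y i))"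
  let ?h = "weighted_ops T K (particle_weight \<phi>) n (T \<omega>) (\<lambda>_. 1)"
  have gi: "(\<lambda>y. growth n (T \<omega>) (y i)) \<in> borel_measurable XN" if "i < N" for i
    by (rule measurable_compose[OF _ measurable_growth[OF T\<omega>]]) (use that in \<open>auto intro: measurable_component_singleton\<close>)
  have "?k \<in> borel_measurable XN"
    by (intro borel_measurable_times_ennreal borel_measurable_const borel_measurable_sum gi) simp
  then have km[measurable]: "?k \<in> borel_measurable (K (\<omega>, x))" using measurable_cong_sets[OF K'(2) refl] by blast
  have \<phi>m[measurable]: "(\<lambda>y. \<phi> (\<omega>, x, y)) \<in> borel_measurable (K (\<omega>, x))"
    using measurable_compose[OF measurable_Pair[OF measurable_const[OF \<omega>] measurable_Pair1'[OF x]]] \<phi>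
      measurable_cong_sets[OF K'(2) refl]
    unfolding RN_version_def by blast
  have "(ennreal (1 / N) * (\<Sum>i<N. growth (Suc n) \<omega> (x i)))\<^sup>2 = (?p * (\<integral>\<^sup>+y. ?k y \<partial>particle_kernel N X G M (\<omega>, x)))\<^sup>2"
    unfolding weighted_ops_Suc' particle_unbiased[OF \<omega> x measurable_growth[OF T\<omega>]] ..
  also have "\<dots> = ?p\<^sup>2 * (\<integral>\<^sup>+y. \<phi> (\<omega>, x, y) * ?k y * 1 \<partial>K (\<omega>, x))\<^sup>2"
  proof -
    have "particle_kernel N X G M (\<omega>, x) = density (K (\<omega>, x)) (\<lambda>y. \<phi> (\<omega>, x, y))"
      using \<phi> \<omega> x by (simp add: RN_version_def)
    then have "(\<integral>\<^sup>+y. ?k y \<partial>particle_kernel N X G M (\<omega>, x)) = (\<integral>\<^sup>+y. \<phi> (\<omega>, x, y) * ?k y \<partial>K (\<omega>, x))"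
      by (simp only:) (rule nn_integral_density[OF \<phi>m km])
    then show ?thesis by (simp add: power_mult_distrib)
  qed
  also have "\<dots> \<le> ?p\<^sup>2 * ((\<integral>\<^sup>+y. (\<phi> (\<omega>, x, y) * ?k y)\<^sup>2 \<partial>K (\<omega>, x)) * (\<integral>\<^sup>+y. 1\<^sup>2 \<partial>K (\<omega>, x)))"
    by (intro mult_left_mono Cauchy_Schwarz_nn_integral) measurable
  also have "\<dots> = (\<integral>\<^sup>+y. ?p\<^sup>2 * (\<phi> (\<omega>, x, y) * ?k y)\<^sup>2 \<partial>K (\<omega>, x))"
    by (simp add: K.emeasure_space_1 nn_integral_cmult)
  also have "\<dots> \<le> (\<integral>\<^sup>+y. particle_weight \<phi> (\<omega>, x, y) * ?h y \<partial>K (\<omega>, x))"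
  proof (rule nn_integral_mono)
    fix y assume "y \<in> space (K (\<omega>, x))"
    then have "y \<in> space XN" using sets_eq_imp_space_eq[OF K'(2)] by simp
    then have "(?k y)\<^sup>2 \<le> ?h y" by (rule Suc.IH[OF T\<omega>])
    then show "?p\<^sup>2 * (\<phi> (\<omega>, x, y) * ?k y)\<^sup>2 \<le> particle_weight \<phi> (\<omega>, x, y) * ?h y"
      by (simp add: particle_weight_def power_mult_distrib mult.assoc mult_left_mono)
  qed
  finally show ?case by (simp add: weighted_ops_Suc' weighted_op_def)
qed

text \<open>Equality of the one-step operators at every state propagates through the iteration. A
  rate found for one version thus belongs to all of them.\<close>

lemma weighted_ops_RN_version_unique:
  assumes K: "K \<in> admissible_kernels W X \<nu> N"
    and \<phi>: "RN_version W XN K (particle_kernel N X G M) \<phi>"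
    and \<psi>: "RN_version W XN K (particle_kernel N X G M) \<psi>"
    and \<omega>: "\<omega> \<in> space W" and x: "x \<in> space XN"
  shows "weighted_ops T K (particle_weight \<psi>) n \<omega> f x = weighted_ops T K (particle_weight \<phi>) n \<omega> f x"
proof -
  have Km: "K \<in> W \<Otimes>\<^sub>M XN \<rightarrow>\<^sub>M prob_algebra XN" using K by (simp add: admissible_kernels_def)
  obtain \<rho> a b where "random_weighted_kernel W XN T K (particle_weight \<phi>) \<rho> a b"
    by (rule random_weighted_kernel_particle[OF K \<phi>])
  then interpret random_weighted_kernel W XN T K "particle_weight \<phi>" \<rho> a b .
  show ?thesis using x
  proof (induction n arbitrary: f x)
    case (Suc n)
    have T\<omega>: "(T ^^ n) \<omega> \<in> space W" by (rule T_space[OF \<omega>])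
    show ?case unfolding weighted_ops_Suc Suc.IH[OF Suc.prems]
      by (intro antisym Qs_mono \<omega> Suc.prems)
         (simp_all add: weighted_op_RN_version_unique[OF Km \<phi> \<psi> T\<omega>])
  qed simp
qed

theorem relative_variance_growth:
  assumes P: "prob_space P" "sets P = sets W" "measure_preserving P T" "ergodic P T"
    and K: "K \<in> admissible_kernels W X \<nu> N"
  shows "\<exists>\<Upsilon>\<ge>0. \<forall>\<mu> \<phi>. prob_space \<mu> \<longrightarrow> sets \<mu> = sets X \<longrightarrow>
    RN_version W XN K (particle_kernel N X G M) \<phi> \<longrightarrow>
    (AE \<omega> in P. (\<lambda>n. ereal (1 / real n) * ln_ennreal
        ((\<integral>\<^sup>+z. (\<Prod>p<n. particle_weight \<phi> ((T ^^ p) \<omega>, z p, z (Suc p)))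
            \<partial>markov_law XN (pow_measure N \<mu>) (\<lambda>n s. K ((T ^^ n) \<omega>, s))) /
         (\<integral>\<^sup>+x. (\<Prod>p<n. weight ((T ^^ p) \<omega>, x p, x (Suc p))) \<partial>markov_law X \<mu> (\<lambda>n s. M ((T ^^ n) \<omega>, s)))\<^sup>2))
      \<longlonglongrightarrow> ereal \<Upsilon>)"
proof (cases "\<exists>\<phi>. RN_version W XN K (particle_kernel N X G M) \<phi>")
  case False
  \<comment> \<open>Without any version of the density the statement is vacuous, so an arbitrary
    nonnegative constant will do.\<close>
  then show ?thesis by (intro exI[of _ 0]) auto
next
  case True
  then obtain \<psi> where \<psi>: "RN_version W XN K (particle_kernel N X G M) \<psi>" ..
  have Km: "K \<in> W \<Otimes>\<^sub>M XN \<rightarrow>\<^sub>M prob_algebra XN" using K by (simp add: admissible_kernels_def)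
  have space_P: "space P = space W" using P(2) sets_eq_imp_space_eq by blast
  let ?h = "\<lambda>\<phi> n \<omega>. weighted_ops T K (particle_weight \<phi>) n \<omega> (\<lambda>_. 1)"
  obtain a b where "random_weighted_kernel W X T M weight \<nu> a b" by (rule random_weighted_kernel_weight)
  then interpret D: random_weighted_kernel W X T M weight \<nu> a b .
  obtain \<rho> a' b' where "random_weighted_kernel W XN T K (particle_weight \<psi>) \<rho> a' b'"
    by (rule random_weighted_kernel_particle[OF K \<psi>])
  then interpret E: random_weighted_kernel W XN T K "particle_weight \<psi>" \<rho> a' b' .
  obtain LD where LD: "AE \<omega> in P. \<forall>\<mu>. prob_space \<mu> \<longrightarrow> sets \<mu> = sets X \<longrightarrow>
    (\<forall>n. 0 < (\<integral>\<^sup>+x. growth n \<omega> x \<partial>\<mu>) \<and> (\<integral>\<^sup>+x. growth n \<omega> x \<partial>\<mu>) < \<infinity>) \<and>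
    (\<lambda>n. ln (enn2real (\<integral>\<^sup>+x. growth n \<omega> x \<partial>\<mu>)) / real n) \<longlonglongrightarrow> LD"
    using D.growth_rate[OF P] by blast
  obtain LE where LE: "AE \<omega> in P. \<forall>\<mu>. prob_space \<mu> \<longrightarrow> sets \<mu> = sets XN \<longrightarrow>
    (\<forall>n. 0 < (\<integral>\<^sup>+x. ?h \<psi> n \<omega> x \<partial>\<mu>) \<and> (\<integral>\<^sup>+x. ?h \<psi> n \<omega> x \<partial>\<mu>) < \<infinity>) \<and>
    (\<lambda>n. ln (enn2real (\<integral>\<^sup>+x. ?h \<psi> n \<omega> x \<partial>\<mu>)) / real n) \<longlonglongrightarrow> LE"
    using E.growth_rate[OF P] by blast
  have nonneg: "0 \<le> LE - 2 * LD"
  proof -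
    \<comment> \<open>The inequality does not involve \<open>\<omega>\<close>; proved almost surely,
      it holds because \<open>P\<close> is a probability measure.\<close>
    have "AE \<omega> in P. 0 \<le> LE - 2 * LD"
      using LD LE AE_space
    proof eventually_elim
      case (elim \<omega>)
      then have \<omega>: "\<omega> \<in> space W" by (simp add: space_P)
      obtain x0 where x0: "x0 \<in> space X" by (rule D.obtain_point)
      \<comment> \<open>All particles start at the same point, so their average growth is the growth
        from \<open>x0\<close>. Dirac initial laws turn both rates into rates at these
        points.\<close>
      let ?x = "restrict (\<lambda>_. x0) {..<N}"
      have x: "?x \<in> space XN" using x0 by (simp add: space_PiM)
      have gm: "growth n \<omega> \<in> borel_measurable X" for n by (rule measurable_growth[OF \<omega>])
      have hm: "?h \<psi> n \<omega> \<in> borel_measurable XN" for n by (rule E.measurable_Qs[OF _ \<omega>]) simp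
      have Ig: "(\<integral>\<^sup>+y. growth n \<omega> y \<partial>return X x0) = growth n \<omega> x0" for n by (rule nn_integral_return[OF x0 gm])
      have Ih: "(\<integral>\<^sup>+y. ?h \<psi> n \<omega> y \<partial>return XN ?x) = ?h \<psi> n \<omega> ?x" for n by (rule nn_integral_return[OF x hm])
      have gl: "0 < growth n \<omega> x0 \<and> growth n \<omega> x0 < \<infinity>" "(\<lambda>n. ln (enn2real (growth n \<omega> x0)) / real n) \<longlonglongrightarrow> LD" for n
        using elim(1)[rule_format, of "return X x0"] prob_space_return[OF x0] unfolding Ig by auto
      have hl: "0 < ?h \<psi> n \<omega> ?x \<and> ?h \<psi> n \<omega> ?x < \<infinity>" "(\<lambda>n. ln (enn2real (?h \<psi> n \<omega> ?x)) / real n) \<longlonglongrightarrow> LE" for n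
        using elim(2)[rule_format, of "return XN ?x"] prob_space_return[OF x] unfolding Ih by auto
      have "2 * (ln (enn2real (growth n \<omega> x0)) / real n) \<le> ln (enn2real (?h \<psi> n \<omega> ?x)) / real n" for n
      proof -
        have N1: "ennreal (1 / N) * of_nat N = 1"
          using N ennreal_mult'[of "1 / real N" "real N"] by (simp add: ennreal_of_nat_eq_real_of_nat)
        have "ennreal (1 / N) * (\<Sum>i<N. growth n \<omega> (?x i)) = (ennreal (1 / N) * of_nat N) * growth n \<omega> x0"
          by (simp add: mult.assoc)
        then have le: "(growth n \<omega> x0)\<^sup>2 \<le> ?h \<psi> n \<omega> ?x"
          using particle_second_moment[OF Km \<psi> \<omega> x, of n] unfolding N1 by simp
        obtain p q where pq: "growth n \<omega> x0 = ennreal p" "?h \<psi> n \<omega> ?x = ennreal q" "0 < p" "0 < q"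
          using gl(1)[of n] hl(1)[of n] by (cases "growth n \<omega> x0"; cases "?h \<psi> n \<omega> ?x") auto
        have "p\<^sup>2 \<le> q" using le pq by (simp add: ennreal_power)
        then have "ln (p\<^sup>2) \<le> ln q" using pq by simp
        then have "2 * ln p \<le> ln q" using pq by (simp add: ln_realpow)
        then show ?thesis using pq by (simp add: divide_right_mono)
      qed
      then have "2 * LD \<le> LE"
        by (intro LIMSEQ_le[OF tendsto_mult_left[OF gl(2)] hl(2)]) auto
      then show ?case by simp
    qed
    then show ?thesis using prob_space.AE_const[OF P(1)] by simp
  qed
  show ?thesis
  proof (intro exI[of _ "LE - 2 * LD"] conjI allI impI nonneg)
    fix \<mu> :: "'x measure" and \<phi>
    assume \<mu>: "prob_space \<mu>" "sets \<mu> = sets X" and \<phi>: "RN_version W XN K (particle_kernel N X G M) \<phi>"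
    have \<mu>N: "prob_space (pow_measure N \<mu>)" "sets (pow_measure N \<mu>) = sets XN"
      by (intro prob_space_PiM \<mu>) (intro sets_PiM_cong refl \<mu>)
    \<comment> \<open>The numerator is first expressed through the given version
      \<open>\<phi>\<close> and then rewritten with the reference version \<open>\<psi>\<close>, for
      which \<open>LE\<close> was chosen.\<close>
    obtain \<rho>' c d where "random_weighted_kernel W XN T K (particle_weight \<phi>) \<rho>' c d"
      by (rule random_weighted_kernel_particle[OF K \<phi>])
    then interpret F: random_weighted_kernel W XN T K "particle_weight \<phi>" \<rho>' c d .
    let ?n = "\<lambda>n \<omega>. \<integral>\<^sup>+z. (\<Prod>p<n. particle_weight \<phi> ((T ^^ p) \<omega>, z p, z (Suc p)))
            \<partial>markov_law XN (pow_measure N \<mu>) (\<lambda>n s. K ((T ^^ n) \<omega>, s))"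
    let ?d = "\<lambda>n \<omega>. \<integral>\<^sup>+x. (\<Prod>p<n. weight ((T ^^ p) \<omega>, x p, x (Suc p))) \<partial>markov_law X \<mu> (\<lambda>n s. M ((T ^^ n) \<omega>, s))"
    show "AE \<omega> in P. (\<lambda>n. ereal (1 / real n) * ln_ennreal (?n n \<omega> / (?d n \<omega>)\<^sup>2)) \<longlonglongrightarrow> ereal (LE - 2 * LD)"
      using LD LE AE_space
    proof eventually_elim
      case (elim \<omega>)
      then have \<omega>: "\<omega> \<in> space W" by (simp add: space_P)
      have d: "?d n \<omega> = (\<integral>\<^sup>+x. growth n \<omega> x \<partial>\<mu>)" for n by (rule D.nn_integral_env[OF \<mu> \<omega>])
      have n: "?n n \<omega> = (\<integral>\<^sup>+x. ?h \<psi> n \<omega> x \<partial>pow_measure N \<mu>)" for n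
        unfolding F.nn_integral_env[OF \<mu>N \<omega>]
        by (intro nn_integral_cong weighted_ops_RN_version_unique[OF K \<psi> \<phi> \<omega>])
           (simp add: sets_eq_imp_space_eq[OF \<mu>N(2)])
      have dl: "0 < ?d n \<omega>" "?d n \<omega> < \<infinity>" "(\<lambda>n. ln (enn2real (?d n \<omega>)) / real n) \<longlonglongrightarrow> LD" for n
        using elim(1) \<mu> unfolding d by blast+
      have nl: "0 < ?n n \<omega>" "?n n \<omega> < \<infinity>" "(\<lambda>n. ln (enn2real (?n n \<omega>)) / real n) \<longlonglongrightarrow> LE" for n
        using elim(2) \<mu>N unfolding n by blast+
      \<comment> \<open>Positivity and finiteness of numerator and denominator keep
        \<open>ln_ennreal\<close> away from its infinite values. The identity includes
        \<open>n = 0\<close>, where division by zero makes both sides 0.\<close>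
      have "ereal (1 / real n) * ln_ennreal (?n n \<omega> / (?d n \<omega>)\<^sup>2)
          = ereal (ln (enn2real (?n n \<omega>)) / real n - 2 * (ln (enn2real (?d n \<omega>)) / real n))" for n
      proof -
        obtain p q where pq: "?n n \<omega> = ennreal p" "?d n \<omega> = ennreal q" "0 < p" "0 < q"
          using dl(1,2)[of n] nl(1,2)[of n] by (cases "?n n \<omega>"; cases "?d n \<omega>") auto
        have "ennreal p / (ennreal q)\<^sup>2 = ennreal (p / q\<^sup>2)"
          using pq by (simp add: ennreal_power divide_ennreal)
        moreover have "ln_ennreal (ennreal (p / q\<^sup>2)) = ereal (ln p - 2 * ln q)"
          using pq by (simp add: ln_ennreal_def ln_div ln_realpow)
        ultimately show ?thesis using pq by (simp add: diff_divide_distrib)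
      qed
      then show ?case
        by (simp only:) (intro tendsto_intros dl nl)
    qed
  qed
qed

end

theorem proposition4:
  fixes X :: "'x measure" and Y :: "'y measure"
    and P :: "(int \<Rightarrow> 'y) measure"
    and M :: "(int \<Rightarrow> 'y) \<times> 'x \<Rightarrow> 'x measure"
    and G :: "(int \<Rightarrow> 'y) \<times> 'x \<Rightarrow> real"
    and \<nu> :: "'x measure"
    and \<beta> \<epsilon>m \<epsilon>p :: real
    and N :: nat
    and M' :: "(int \<Rightarrow> 'y) \<times> (nat \<Rightarrow> 'x) \<Rightarrow> (nat \<Rightarrow> 'x) measure"
  assumes "prob_space P" and "sets P = sets (path_space Y)"
    and "M \<in> path_space Y \<Otimes>\<^sub>M X \<rightarrow>\<^sub>M prob_algebra X"
    and "G \<in> borel_measurable (path_space Y \<Otimes>\<^sub>M X)"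
    and "\<And>\<omega> x. \<omega> \<in> space (path_space Y) \<Longrightarrow> x \<in> space X \<Longrightarrow> 0 < G (\<omega>, x)"
    and "\<exists>B. \<forall>\<omega>\<in>space (path_space Y). \<forall>x\<in>space X. G (\<omega>, x) \<le> B"
    and "measure_preserving P seq_shift" and "ergodic P seq_shift"
    and "1 \<le> \<beta>" and "0 < \<epsilon>m" and "0 < \<epsilon>p"
    and "prob_space \<nu>" and "sets \<nu> = sets X"
    and "\<And>\<omega> \<omega>' x x'. \<omega> \<in> space (path_space Y) \<Longrightarrow> \<omega>' \<in> space (path_space Y) \<Longrightarrow>
           x \<in> space X \<Longrightarrow> x' \<in> space X \<Longrightarrow> G (\<omega>, x) / G (\<omega>', x') \<le> \<beta>"
    and "\<And>\<omega> x A. \<omega> \<in> space (path_space Y) \<Longrightarrow> x \<in> space X \<Longrightarrow> A \<in> sets X \<Longrightarrow>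
           \<epsilon>m * measure \<nu> A \<le> measure (M (\<omega>, x)) A \<and>
           measure (M (\<omega>, x)) A \<le> \<epsilon>p * measure \<nu> A"
    and "1 \<le> N"
    and "M' \<in> admissible_kernels (path_space Y) X \<nu> N"
  shows "\<exists>\<Upsilon>::real. 0 \<le> \<Upsilon> \<and>
    (\<forall>\<mu>0 \<phi>. prob_space \<mu>0 \<longrightarrow> sets \<mu>0 = sets X \<longrightarrow>
       RN_version (path_space Y) (pow_measure N X) M' (particle_kernel N X G M) \<phi> \<longrightarrow>
       (AE \<omega> in P.
          (\<lambda>n. ereal (1 / real n) * ln_ennreal (rel_variance N X \<mu>0 G M M' \<phi> \<omega> n))
            \<longlonglongrightarrow> ereal \<Upsilon>))"
proof -
  \<comment> \<open>Measurability of the shift is part of measure preservation for \<open>P\<close>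
    and transfers along the equality of the sigma-algebras.\<close>
  have "seq_shift \<in> path_space Y \<rightarrow>\<^sub>M path_space Y"
    using assms(7) measurable_cong_sets[OF assms(2) assms(2)] by (simp add: measure_preserving_def)
  then interpret particle_model "path_space Y" X seq_shift M G \<nu> \<beta> \<epsilon>m \<epsilon>p N
    by (rule particle_model.intro) (fact assms)+
  show ?thesis
    using relative_variance_growth[OF assms(1,2,7,8,17)]
    by (simp add: rel_variance_def env_law_def particle_weight_def weight_def)
qed

end
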